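(* Let $(M,g)$ be a compact Riemannian manifold without boundary, $H:M\to\mathbb{R}$ smooth, and $d\mu=\frac1Z e^{-H(x)}dx$. Let $X$ be a random point of $M$ with law $\mu$ and let $(X_t)_{t\ge0}$ be the diffusion on $M$ associated with $H$, started at $X_0=X$. Let $f_1,\dots,f_k:M\to\mathbb{R}$ be smooth functions, and let $W=(f_1(X),\dots,f_k(X))$ and $W_t=(f_1(X_t),\dots,f_k(X_t))$. Then for every $\rho>0$, $$\lim_{t\to0}\frac1t\,\mathbb{E}\big[|W_t-W|^2\,\mathbb{I}(|W_t-W|^2>\rho)\big]=0.$$
   Context: $dx$ is the Riemannian volume measure and the constant $\frac1Z$ normalizes $\mu$ to a probability measure. The diffusion associated with $H$ is $X_t=\pi(U_t)$, where $\pi:\mathcal{O}(M)\to M$ is the orthonormal frame bundle and $U_t$ solves the Stratonovich equation $dU_t=\sum_{i=1}^d\mathcal{H}^i(U_t)\circ dB^i_t-\frac12\widetilde{\nabla H}(U_t)\,dt$, $\pi(U_0)=X$; here $d=\dim M$, $B=(B^1,\dots,B^d)$ is a standard Brownian motion in $\mathbb{R}^d$, $\mathcal{H}^i(\phi)$ is the horizontal lift (for the Levi-Civita connection) at the frame $\phi=(x,\phi^1,\dots,\phi^d)$ of the vector $\phi^i\in T_xM$, and $\widetilde{\nabla H}$ is the horizontal lift of the gradient field $\nabla H$. Equivalently, $X_t$ is the diffusion with generator $\frac12(\Delta-\nabla H)$, where $\Delta$ is the Laplace--Beltrami operator and $\nabla H$ acts by $f\mapsto\langle\nabla H,\nabla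 f\rangle$; it is reversible with respect to $\mu$. $\mathbb{I}(\cdot)$ denotes an indicator. *)

theory Defs
  imports "HOL-Probability.Probability"
begin

section \<open>Smooth functions on open sets\<close>

text \<open>\<open>smooth_on\<close> includes openness of the domain: the derivatives below are taken at \<open>x\<close> in the full
  space, so differentiability would otherwise depend on the values of \<open>f\<close> outside of \<open>S\<close>.\<close>

primrec times_cont_diff_on ::
    "nat \<Rightarrow> 'a::euclidean_space set \<Rightarrow> ('a \<Rightarrow> 'b::real_normed_vector) \<Rightarrow> bool" where
  "times_cont_diff_on 0 S f \<longleftrightarrow> continuous_on S f"
| "times_cont_diff_on (Suc k) S f \<longleftrightarrow>
     (\<forall>x\<in>S. f differentiable (at x)) \<and>
     (\<forall>v. times_cont_diff_on k S (\<lambda>x. frechet_derivative f (at x) v))"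

definition smooth_on :: "'a::euclidean_space set \<Rightarrow> ('a \<Rightarrow> 'b::real_normed_vector) \<Rightarrow> bool" where
  "smooth_on S f \<longleftrightarrow> open S \<and> (\<forall>k. times_cont_diff_on k S f)"


section \<open>Smooth manifolds and Riemannian metrics\<close>

text \<open>The manifold is the whole type \<open>'m\<close>, modelled on \<open>real ^ 'n\<close>, so its dimension is
  \<open>CARD('n)\<close>. A chart is a pair of its domain and its coordinate map.\<close>

type_synonym ('m, 'n) chart = "'m set \<times> ('m \<Rightarrow> real ^ 'n)"

abbreviation chart_dom :: "('m, 'n) chart \<Rightarrow> 'm set" where
  "chart_dom c \<equiv> fst c"

abbreviation chart_map :: "('m, 'n) chart \<Rightarrow> 'm \<Rightarrow> real ^ 'n" where
  "chart_map c \<equiv> snd c"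

abbreviation chart_image :: "('m, 'n) chart \<Rightarrow> (real ^ 'n) set" where
  "chart_image c \<equiv> chart_map c ` chart_dom c"

definition chart_inv :: "('m, 'n) chart \<Rightarrow> real ^ 'n \<Rightarrow> 'm" where
  "chart_inv c = inv_into (chart_dom c) (chart_map c)"

definition smooth_atlas ::
    "('m::{t2_space, second_countable_topology}, 'n::finite) chart set \<Rightarrow> bool" where
  "smooth_atlas A \<longleftrightarrow>
     (\<Union>c\<in>A. chart_dom c) = UNIV \<and>
     (\<forall>c\<in>A. open (chart_dom c) \<and> open (chart_image c) \<and>
        homeomorphism (chart_dom c) (chart_image c) (chart_map c) (chart_inv c)) \<and>
     (\<forall>c\<in>A. \<forall>c'\<in>A. smooth_on (chart_map c ` (chart_dom c \<inter> chart_dom c'))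
        (chart_map c' \<circ> chart_inv c))"

definition smooth_fun ::
    "('m::{t2_space, second_countable_topology}, 'n::finite) chart set \<Rightarrow> ('m \<Rightarrow> real) \<Rightarrow> bool" where
  "smooth_fun A f \<longleftrightarrow> (\<forall>c\<in>A. smooth_on (chart_image c) (f \<circ> chart_inv c))"

text \<open>A Riemannian metric is a symmetric positive definite covariant 2-tensor field, given by its
  components in each chart: \<open>g c p $ i $ j\<close> is the inner product at \<open>p\<close> of the coordinate vector
  fields \<open>i\<close> and \<open>j\<close> of the chart \<open>c\<close>. The last clause is the tensor transformation law,
  with \<open>J\<close> the Jacobian matrix of the change of coordinates from \<open>c\<close> to \<open>c'\<close>.\<close>

definition riemannian_metric ::
    "('m::{t2_space, second_countable_topology}, 'n::finite) chart set \<Rightarrow>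
     (('m, 'n) chart \<Rightarrow> 'm \<Rightarrow> real ^ 'n ^ 'n) \<Rightarrow> bool" where
  "riemannian_metric A g \<longleftrightarrow>
     (\<forall>c\<in>A. \<forall>i j. smooth_on (chart_image c) (\<lambda>y. g c (chart_inv c y) $ i $ j)) \<and>
     (\<forall>c\<in>A. \<forall>p\<in>chart_dom c. transpose (g c p) = g c p \<and>
        (\<forall>v. v \<noteq> 0 \<longrightarrow> v \<bullet> (g c p *v v) > 0)) \<and>
     (\<forall>c\<in>A. \<forall>c'\<in>A. \<forall>p\<in>chart_dom c \<inter> chart_dom c'.
        let J = matrix (frechet_derivative (chart_map c' \<circ> chart_inv c) (at (chart_map c p)))
        in g c p = transpose J ** g c' p ** J)"

definition compact_riemannian_manifold ::
    "('m::{t2_space, second_countable_topology}, 'n::finite) chart set \<Rightarrow>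
     (('m, 'n) chart \<Rightarrow> 'm \<Rightarrow> real ^ 'n ^ 'n) \<Rightarrow> bool" where
  "compact_riemannian_manifold A g \<longleftrightarrow>
     compact (UNIV :: 'm set) \<and> smooth_atlas A \<and> riemannian_metric A g"


section \<open>Volume measure and the Gibbs measure of a potential\<close>

definition volume_density ::
    "(('m, 'n::finite) chart \<Rightarrow> 'm \<Rightarrow> real ^ 'n ^ 'n) \<Rightarrow> ('m, 'n) chart \<Rightarrow> 'm \<Rightarrow> real" where
  "volume_density g c p = sqrt (det (g c p))"

text \<open>The unique Borel measure which in the coordinates of every chart has density
  \<open>sqrt (det g)\<close> with respect to Lebesgue measure.\<close>

definition riemannian_volume ::
    "('m::{t2_space, second_countable_topology}, 'n::finite) chart set \<Rightarrow>
     (('m, 'n) chart \<Rightarrow> 'm \<Rightarrow> real ^ 'n ^ 'n) \<Rightarrow> 'm measure" where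
  "riemannian_volume A g = (THE \<nu>. sets \<nu> = sets borel \<and>
     (\<forall>c\<in>A. \<forall>B\<in>sets borel. B \<subseteq> chart_dom c \<longrightarrow>
        emeasure \<nu> B =
          (\<integral>\<^sup>+ y\<in>chart_map c ` B. ennreal (volume_density g c (chart_inv c y)) \<partial>lborel)))"

definition gibbs_measure ::
    "('m::{t2_space, second_countable_topology}, 'n::finite) chart set \<Rightarrow>
     (('m, 'n) chart \<Rightarrow> 'm \<Rightarrow> real ^ 'n ^ 'n) \<Rightarrow> ('m \<Rightarrow> real) \<Rightarrow> 'm measure" where
  "gibbs_measure A g H =
     (let Z = (\<integral>x. exp (- H x) \<partial>riemannian_volume A g)
      in density (riemannian_volume A g) (\<lambda>x. ennreal (exp (- H x) / Z)))"


section \<open>Gradient, Laplace--Beltrami operator and generator\<close>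

text \<open>Vector fields are represented by their components in a chart.\<close>

definition coord_deriv ::
    "('m, 'n::finite) chart \<Rightarrow> 'n \<Rightarrow> ('m \<Rightarrow> real) \<Rightarrow> 'm \<Rightarrow> real" where
  "coord_deriv c i f p =
     frechet_derivative (f \<circ> chart_inv c) (at (chart_map c p)) (axis i 1)"

definition gradient ::
    "(('m, 'n::finite) chart \<Rightarrow> 'm \<Rightarrow> real ^ 'n ^ 'n) \<Rightarrow> ('m, 'n) chart \<Rightarrow>
     ('m \<Rightarrow> real) \<Rightarrow> 'm \<Rightarrow> real ^ 'n" where
  "gradient g c f p = matrix_inv (g c p) *v (\<chi> i. coord_deriv c i f p)"

definition metric_inner ::
    "(('m, 'n::finite) chart \<Rightarrow> 'm \<Rightarrow> real ^ 'n ^ 'n) \<Rightarrow> ('m, 'n) chart \<Rightarrow>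
     'm \<Rightarrow> real ^ 'n \<Rightarrow> real ^ 'n \<Rightarrow> real" where
  "metric_inner g c p u v = u \<bullet> (g c p *v v)"

definition divergence ::
    "(('m, 'n::finite) chart \<Rightarrow> 'm \<Rightarrow> real ^ 'n ^ 'n) \<Rightarrow> ('m, 'n) chart \<Rightarrow>
     ('m \<Rightarrow> real ^ 'n) \<Rightarrow> 'm \<Rightarrow> real" where
  "divergence g c V p =
     (\<Sum>i\<in>UNIV. coord_deriv c i (\<lambda>q. volume_density g c q * V q $ i) p) / volume_density g c p"

definition laplace_beltrami ::
    "(('m, 'n::finite) chart \<Rightarrow> 'm \<Rightarrow> real ^ 'n ^ 'n) \<Rightarrow> ('m, 'n) chart \<Rightarrow>
     ('m \<Rightarrow> real) \<Rightarrow> 'm \<Rightarrow> real" where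
  "laplace_beltrami g c f p = divergence g c (gradient g c f) p"

text \<open>The operator mapping \<open>f\<close> to half of \<open>\<Delta>f - \<langle>\<nabla>H, \<nabla>f\<rangle>\<close>. For smooth \<open>f\<close> the value at \<open>p\<close>
  does not depend on the chart around \<open>p\<close> that is used to compute it.\<close>

definition generator ::
    "('m::{t2_space, second_countable_topology}, 'n::finite) chart set \<Rightarrow>
     (('m, 'n) chart \<Rightarrow> 'm \<Rightarrow> real ^ 'n ^ 'n) \<Rightarrow> ('m \<Rightarrow> real) \<Rightarrow> ('m \<Rightarrow> real) \<Rightarrow> 'm \<Rightarrow> real" where
  "generator A g H f p =
     (let c = (SOME c. c \<in> A \<and> p \<in> chart_dom c)
      in (laplace_beltrami g c f p -
          metric_inner g c p (gradient g c H p) (gradient g c f p)) / 2)"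


section \<open>Diffusions with a given generator\<close>

text \<open>Time is \<open>{0..}\<close>; values of processes at negative times are irrelevant.\<close>

definition natural_filtration ::
    "'w measure \<Rightarrow> (real \<Rightarrow> 'w \<Rightarrow> 'm::topological_space) \<Rightarrow> real \<Rightarrow> 'w measure" where
  "natural_filtration P X t =
     sigma (space P) {X s -` B \<inter> space P | s B. 0 \<le> s \<and> s \<le> t \<and> B \<in> sets borel}"

definition is_martingale ::
    "'w measure \<Rightarrow> (real \<Rightarrow> 'w measure) \<Rightarrow> (real \<Rightarrow> 'w \<Rightarrow> real) \<Rightarrow> bool" where
  "is_martingale P F N \<longleftrightarrow>
     (\<forall>t\<ge>0. integrable P (N t) \<and> N t \<in> borel_measurable (F t)) \<and>
     (\<forall>s t. 0 \<le> s \<and> s \<le> t \<longrightarrow> (AE \<omega> in P. real_cond_exp P (F s) (N t) \<omega> = N s \<omega>))"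

text \<open>A diffusion generated by \<open>L\<close>, acting on the smooth functions: a process with continuous
  paths that solves the martingale problem for \<open>L\<close>. Taking the natural filtration is the weakest
  requirement: a martingale for a larger filtration that is adapted to the natural one is also a
  martingale for the natural one. As all test functions are bounded and the manifold is compact,
  martingales and local martingales amount to the same here.\<close>

definition diffusion_generated_by ::
    "('m::{t2_space, second_countable_topology}, 'n::finite) chart set \<Rightarrow>
     (('m \<Rightarrow> real) \<Rightarrow> 'm \<Rightarrow> real) \<Rightarrow> 'w measure \<Rightarrow> (real \<Rightarrow> 'w \<Rightarrow> 'm) \<Rightarrow> bool" where
  "diffusion_generated_by A L P X \<longleftrightarrow>
     (\<forall>t\<ge>0. X t \<in> measurable P borel) \<and>
     (\<forall>\<omega>\<in>space P. continuous_on {0..} (\<lambda>t. X t \<omega>)) \<and>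
     (\<forall>f. smooth_fun A f \<longrightarrow>
        is_martingale P (natural_filtration P X)
          (\<lambda>t \<omega>. f (X t \<omega>) - f (X 0 \<omega>) - (\<integral>s\<in>{0..t}. L f (X s \<omega>) \<partial>lborel)))"

end

theory Submission
  imports Defs
begin

text \<open>
The tail second moment of the increment is controlled by fourth moments of the coordinate
increments: on the event \<open>|v|\<^sup>2 > \<rho>\<close> one has \<open>|v|\<^sup>2 \<le> |v|\<^sup>4 / \<rho>\<close>
(\<open>norm_square_tail_le\<close>). So it suffices that \<open>E (f(X\<^sub>t) - f(X\<^sub>0))\<^sup>4 = o(t)\<close> for a single smooth
\<open>f\<close> (\<open>fourth_moment_small_time\<close>).

Write \<open>L\<close> for the generator. Expanding the fourth power in terms of \<open>f(X\<^sub>t)\<^sup>j\<close> with coefficients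
depending on \<open>X\<^sub>0\<close>, and using that \<open>f(X\<^sub>t)\<^sup>j - f(X\<^sub>0)\<^sup>j - \<integral>\<^sub>0\<^sup>t L(f\<^sup>j)(X\<^sub>s) ds\<close> is a martingale, hence
orthogonal to functions of \<open>X\<^sub>0\<close>, gives
\<open>E (f(X\<^sub>t) - f(X\<^sub>0))\<^sup>4 = E \<integral>\<^sub>0\<^sup>t \<Phi>(X\<^sub>0, X\<^sub>s) ds\<close>, where \<open>\<Phi>(x, y)\<close> is the value at \<open>y\<close> of \<open>L\<close> applied to
\<open>(f - f(x))\<^sup>4\<close>. As \<open>L\<close> is a second order differential operator, \<open>\<Phi>(x, y)\<close> carries a factor
\<open>(f(y) - f(x))\<^sup>2\<close>; it is bounded, and it tends to \<open>0\<close> along each path as \<open>s \<rightarrow> 0\<close>. Dominated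
convergence applied to the time averages of \<open>\<Phi>(X\<^sub>0, X\<^sub>s)\<close> finishes the argument.

This needs \<open>L f\<close> to be continuous, whereas the generator at \<open>p\<close> is computed in an arbitrarily
selected chart around \<open>p\<close>. In a fixed chart the coordinate expression is smooth, so the point is
that it does not depend on the chart (\<open>coord_generator_invariant\<close>). For the first order part this is
linear algebra. For the divergence (\<open>coord_div_invariant\<close>) the derivative of the volume density
produces the logarithmic derivative of the Jacobian determinant, and the derivative of the
transformation law \<open>J V = V' \<circ> \<phi>\<close> of vector fields produces second derivatives of \<open>\<phi>\<close>; the two
cancel by Jacobi's formula (\<open>has_derivative_det\<close>) and the symmetry of second derivatives
(\<open>smooth_on_second_derivative_commute\<close>).
\<close>

section \<open>Calculus of smooth functions\<close>

lemma frechet_derivative_eqI: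
  "(f has_derivative f') (at x) \<Longrightarrow> frechet_derivative f (at x) v = f' v"
  using frechet_derivative_at by metis

lemma has_frechet_derivative:
  "f differentiable (at x) \<Longrightarrow> (f has_derivative frechet_derivative f (at x)) (at x)"
  using frechet_derivative_works by blast

lemma differentiable_transform_open:
  assumes "f differentiable (at x)" "open S" "x \<in> S" "\<And>z. z \<in> S \<Longrightarrow> f z = g z"
  shows "g differentiable (at x)"
  using assms has_derivative_transform_within_open unfolding differentiable_def by metis

lemma times_cont_diff_on_SucD:
  assumes "times_cont_diff_on (Suc k) S f"
  shows "x \<in> S \<Longrightarrow> f differentiable (at x)"
    and "times_cont_diff_on k S (\<lambda>x. frechet_derivative f (at x) v)"
  using assms by simp_all

lemma times_cont_diff_on_cong:
  assumes "open S" "\<And>x. x \<in> S \<Longrightarrow> f x = g x" "times_cont_diff_on k S f"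
  shows "times_cont_diff_on k S g"
  using assms(2,3)
proof (induction k arbitrary: f g)
  case 0
  then show ?case using continuous_on_eq[of S f g] by simp
next
  case (Suc k)
  have D: "frechet_derivative f (at x) v = frechet_derivative g (at x) v" if "x \<in> S" for x v
    using frechet_derivative_transform_within_open[OF times_cont_diff_on_SucD(1)[OF Suc.prems(2) that] assms(1) that]
      Suc.prems(1) by simp
  have "times_cont_diff_on k S (\<lambda>x. frechet_derivative g (at x) v)" for v
    by (rule Suc.IH[OF D times_cont_diff_on_SucD(2)[OF Suc.prems(2)]])
  moreover have "g differentiable (at x)" if "x \<in> S" for x
    using differentiable_transform_open[OF times_cont_diff_on_SucD(1)[OF Suc.prems(2) that] assms(1) that]
      Suc.prems(1) by blast
  ultimately show ?case by simp
qed

text \<open>A function that is differentiable everywhere on \<open>S\<close> is continuous there, so the classes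
  \<open>C\<^sup>k\<close> are nested; the step descends to the directional derivatives.\<close>

lemma times_cont_diff_on_Suc_imp:
  "times_cont_diff_on (Suc k) S f \<Longrightarrow> times_cont_diff_on k S f"
proof (induction k arbitrary: f)
  case 0
  then show ?case
    by (auto intro!: continuous_at_imp_continuous_on differentiable_imp_continuous_within)
next
  case (Suc k)
  show ?case
    unfolding times_cont_diff_on.simps(2)[of k]
    by (intro conjI allI ballI times_cont_diff_on_SucD(1)[OF Suc.prems]
        Suc.IH[OF times_cont_diff_on_SucD(2)[OF Suc.prems]])
qed

lemma smooth_on_imp_open: "smooth_on S f \<Longrightarrow> open S"
  unfolding smooth_on_def by (rule conjunct1)

lemma smooth_on_imp_times_cont_diff_on: "smooth_on S f \<Longrightarrow> times_cont_diff_on k S f"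
  unfolding smooth_on_def by (elim conjE allE)

lemma smooth_on_continuous_on: "smooth_on S f \<Longrightarrow> continuous_on S f"
  using smooth_on_imp_times_cont_diff_on[of S f 0] by simp

lemma smooth_on_differentiable: "smooth_on S f \<Longrightarrow> x \<in> S \<Longrightarrow> f differentiable (at x)"
  using smooth_on_imp_times_cont_diff_on[of S f "Suc 0"] by simp

lemma smooth_on_frechet_derivative:
  assumes "smooth_on S f"
  shows "smooth_on S (\<lambda>x. frechet_derivative f (at x) v)"
  using smooth_on_imp_open[OF assms] smooth_on_imp_times_cont_diff_on[OF assms, of "Suc _"]
  by (simp add: smooth_on_def)

lemma smooth_on_cong:
  assumes "smooth_on S f" "\<And>x. x \<in> S \<Longrightarrow> f x = g x"
  shows "smooth_on S g"
  using assms times_cont_diff_on_cong[of S f g] by (auto simp: smooth_on_def)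

lemma smooth_on_subset:
  assumes "smooth_on S f" "open T" "T \<subseteq> S"
  shows "smooth_on T f"
proof -
  have "times_cont_diff_on k T f" if "times_cont_diff_on k S f" for k
    using that
  proof (induction k arbitrary: f)
    case 0
    then show ?case using assms(3) by (auto intro: continuous_on_subset)
  next
    case (Suc k)
    then show ?case using assms(3) by auto
  qed
  then show ?thesis using assms by (auto simp: smooth_on_def)
qed

lemma times_cont_diff_on_const: "times_cont_diff_on k S (\<lambda>x. c)"
  by (induction k arbitrary: c) auto

lemma times_cont_diff_on_add:
  fixes f h :: "'a::euclidean_space \<Rightarrow> 'b::real_normed_vector"
  assumes "open S" "times_cont_diff_on k S f" "times_cont_diff_on k S h"
  shows "times_cont_diff_on k S (\<lambda>x. f x + h x)"
  using assms(2,3)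
proof (induction k arbitrary: f h)
  case 0
  then show ?case by (simp add: continuous_on_add)
next
  case (Suc k)
  have D: "frechet_derivative f (at x) v + frechet_derivative h (at x) v
      = frechet_derivative (\<lambda>x. f x + h x) (at x) v" if "x \<in> S" for x v
    using Suc.prems that
    by (intro frechet_derivative_eqI[symmetric] has_derivative_add has_frechet_derivative) auto
  have "times_cont_diff_on k S (\<lambda>x. frechet_derivative (\<lambda>x. f x + h x) (at x) v)" for v
    by (rule times_cont_diff_on_cong[OF assms(1)], erule D)
      (intro Suc.IH times_cont_diff_on_SucD(2)[OF Suc.prems(1)] times_cont_diff_on_SucD(2)[OF Suc.prems(2)])
  then show ?case using Suc.prems by (auto intro: differentiable_add)
qed

text \<open>By the Leibniz rule the directional derivatives of a product are built from products of
  functions of class \<open>C\<^sup>k\<close>, since the factors themselves are \<open>C\<^sup>k\<close> when they are \<open>C\<^sup>k\<^sup>+\<^sup>1\<close>.\<close>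

lemma times_cont_diff_on_mult:
  fixes f h :: "'a::euclidean_space \<Rightarrow> real"
  assumes "open S" "times_cont_diff_on k S f" "times_cont_diff_on k S h"
  shows "times_cont_diff_on k S (\<lambda>x. f x * h x)"
  using assms(2,3)
proof (induction k arbitrary: f h)
  case 0
  then show ?case by (simp add: continuous_on_mult)
next
  case (Suc k)
  have D: "f x * frechet_derivative h (at x) v + frechet_derivative f (at x) v * h x
      = frechet_derivative (\<lambda>x. f x * h x) (at x) v" if "x \<in> S" for x v
    using Suc.prems that
    by (intro frechet_derivative_eqI[symmetric] has_derivative_mult has_frechet_derivative) auto
  have "times_cont_diff_on k S (\<lambda>x. frechet_derivative (\<lambda>x. f x * h x) (at x) v)" for v
    by (rule times_cont_diff_on_cong[OF assms(1)], erule D)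
      (intro times_cont_diff_on_add[OF assms(1)] Suc.IH times_cont_diff_on_SucD(2)[OF Suc.prems(1)]
        times_cont_diff_on_SucD(2)[OF Suc.prems(2)] times_cont_diff_on_Suc_imp[OF Suc.prems(1)]
        times_cont_diff_on_Suc_imp[OF Suc.prems(2)])
  then show ?case using Suc.prems by (auto intro: differentiable_mult)
qed

text \<open>The derivative of \<open>1/f\<close> is \<open>-f'/f\<^sup>2\<close>, a product of \<open>f'\<close> with two copies of the function
  itself, for which the induction hypothesis is available.\<close>

lemma times_cont_diff_on_inverse:
  fixes f :: "'a::euclidean_space \<Rightarrow> real"
  assumes "open S" "times_cont_diff_on k S f" "\<And>x. x \<in> S \<Longrightarrow> f x \<noteq> 0"
  shows "times_cont_diff_on k S (\<lambda>x. inverse (f x))"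
  using assms(2)
proof (induction k)
  case 0
  then show ?case using assms(3) by (simp add: continuous_on_inverse)
next
  case (Suc k)
  have D': "((\<lambda>x. inverse (f x)) has_derivative
      (\<lambda>v. - (inverse (f x) * frechet_derivative f (at x) v * inverse (f x)))) (at x)" if "x \<in> S" for x
    by (rule Deriv.has_derivative_inverse[OF assms(3)[OF that]
          has_frechet_derivative[OF times_cont_diff_on_SucD(1)[OF Suc.prems that]]])
  have D: "-1 * (inverse (f x) * frechet_derivative f (at x) v * inverse (f x))
      = frechet_derivative (\<lambda>x. inverse (f x)) (at x) v" if "x \<in> S" for x v
    using frechet_derivative_eqI[OF D'[OF that], of v] by simp
  have "times_cont_diff_on k S (\<lambda>x. frechet_derivative (\<lambda>x. inverse (f x)) (at x) v)" for v
    by (rule times_cont_diff_on_cong[OF assms(1)], erule D)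
      (intro times_cont_diff_on_mult[OF assms(1)] times_cont_diff_on_const Suc.IH
        times_cont_diff_on_SucD(2)[OF Suc.prems] times_cont_diff_on_Suc_imp[OF Suc.prems])
  then show ?case using D' by (auto simp: differentiable_def)
qed

text \<open>As for inverses: the derivative of \<open>\<surd>f\<close> involves \<open>f'\<close> and \<open>1/\<surd>f\<close>, whose regularity is
  reduced to that of \<open>\<surd>f\<close> one order lower.\<close>

lemma times_cont_diff_on_sqrt:
  fixes f :: "'a::euclidean_space \<Rightarrow> real"
  assumes "open S" "times_cont_diff_on k S f" "\<And>x. x \<in> S \<Longrightarrow> f x > 0"
  shows "times_cont_diff_on k S (\<lambda>x. sqrt (f x))"
  using assms(2)
proof (induction k)
  case 0
  then show ?case by (simp add: continuous_on_real_sqrt)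
next
  case (Suc k)
  have D': "((\<lambda>x. sqrt (f x)) has_derivative
      (\<lambda>v. frechet_derivative f (at x) v * (inverse (sqrt (f x)) / 2))) (at x)" if "x \<in> S" for x
    using assms(3)[OF that] has_frechet_derivative[OF times_cont_diff_on_SucD(1)[OF Suc.prems that]]
    by (auto intro!: derivative_eq_intros simp: field_simps)
  have D: "1/2 * (frechet_derivative f (at x) v * inverse (sqrt (f x)))
      = frechet_derivative (\<lambda>x. sqrt (f x)) (at x) v" if "x \<in> S" for x v
    using frechet_derivative_eqI[OF D'[OF that], of v] by simp
  have "sqrt (f x) \<noteq> 0" if "x \<in> S" for x
    using assms(3)[OF that] by simp
  then have I: "times_cont_diff_on k S (\<lambda>x. inverse (sqrt (f x)))"
    by (intro times_cont_diff_on_inverse assms(1) Suc.IH times_cont_diff_on_Suc_imp[OF Suc.prems])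
  have "times_cont_diff_on k S (\<lambda>x. frechet_derivative (\<lambda>x. sqrt (f x)) (at x) v)" for v
    by (rule times_cont_diff_on_cong[OF assms(1)], erule D)
      (intro times_cont_diff_on_mult[OF assms(1)] times_cont_diff_on_const I times_cont_diff_on_SucD(2)[OF Suc.prems])
  then show ?case using D' by (auto simp: differentiable_def)
qed

lemma smooth_on_const: "open S \<Longrightarrow> smooth_on S (\<lambda>x. c)"
  by (simp add: smooth_on_def times_cont_diff_on_const)

lemma smooth_on_add:
  "smooth_on S f \<Longrightarrow> smooth_on S h \<Longrightarrow> smooth_on S (\<lambda>x. f x + h x)"
  by (simp add: smooth_on_def times_cont_diff_on_add)

lemma smooth_on_mult:
  fixes f h :: "'a::euclidean_space \<Rightarrow> real"
  shows "smooth_on S f \<Longrightarrow> smooth_on S h \<Longrightarrow> smooth_on S (\<lambda>x. f x * h x)"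
  by (simp add: smooth_on_def times_cont_diff_on_mult)

lemma smooth_on_divide:
  fixes f h :: "'a::euclidean_space \<Rightarrow> real"
  assumes "smooth_on S f" "smooth_on S h" "\<And>x. x \<in> S \<Longrightarrow> h x \<noteq> 0"
  shows "smooth_on S (\<lambda>x. f x / h x)"
  unfolding divide_inverse
  using assms by (simp add: smooth_on_def times_cont_diff_on_mult times_cont_diff_on_inverse)

lemma smooth_on_sqrt:
  fixes f :: "'a::euclidean_space \<Rightarrow> real"
  shows "smooth_on S f \<Longrightarrow> (\<And>x. x \<in> S \<Longrightarrow> f x > 0) \<Longrightarrow> smooth_on S (\<lambda>x. sqrt (f x))"
  by (simp add: smooth_on_def times_cont_diff_on_sqrt)

lemma smooth_on_sum:
  assumes "open S" "\<And>i. i \<in> I \<Longrightarrow> smooth_on S (f i)"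
  shows "smooth_on S (\<lambda>x. \<Sum>i\<in>I. f i x)"
  using assms(2)
  by (induction I rule: infinite_finite_induct) (auto intro: smooth_on_const smooth_on_add assms(1))

lemma smooth_on_prod:
  fixes f :: "'i \<Rightarrow> 'a::euclidean_space \<Rightarrow> real"
  assumes "open S" "\<And>i. i \<in> I \<Longrightarrow> smooth_on S (f i)"
  shows "smooth_on S (\<lambda>x. \<Prod>i\<in>I. f i x)"
  using assms(2)
  by (induction I rule: infinite_finite_induct) (auto intro: smooth_on_const smooth_on_mult assms(1))

text \<open>A determinant is a polynomial in the entries.\<close>

lemma smooth_on_det:
  fixes M :: "'a::euclidean_space \<Rightarrow> real ^ 'n::finite ^ 'n"
  assumes "open S" "\<And>i j. smooth_on S (\<lambda>x. M x $ i $ j)"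
  shows "smooth_on S (\<lambda>x. det (M x))"
  unfolding det_def
  by (intro smooth_on_sum smooth_on_mult smooth_on_const smooth_on_prod assms)

section \<open>Symmetry of second derivatives\<close>

text \<open>Two applications of the mean value theorem, first in the direction \<open>u\<close> and then in the
  direction \<open>v\<close>. The left-hand side is symmetric in \<open>u\<close> and \<open>v\<close>, which is what makes the mixed
  derivatives agree.\<close>

lemma second_difference_mvt:
  fixes f :: "'a::euclidean_space \<Rightarrow> real"
  assumes t: "t > 0"
    and f: "\<And>z. dist z x \<le> t * (norm u + norm v) \<Longrightarrow> f differentiable (at z)"
    and Df: "\<And>z. dist z x \<le> t * (norm u + norm v) \<Longrightarrow>
      (\<lambda>z. frechet_derivative f (at z) u) differentiable (at z)"
  shows "\<exists>z. dist z x \<le> t * (norm u + norm v) \<and>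
    f (x + t *\<^sub>R u + t *\<^sub>R v) - f (x + t *\<^sub>R u) - f (x + t *\<^sub>R v) + f x =
    t * t * frechet_derivative (\<lambda>z. frechet_derivative f (at z) u) (at z) v"
proof -
  have near: "dist (x + r *\<^sub>R u + s *\<^sub>R v) x \<le> t * (norm u + norm v)"
    if "0 \<le> r" "r \<le> t" "0 \<le> s" "s \<le> t" for r s
  proof -
    have "dist (x + r *\<^sub>R u + s *\<^sub>R v) x = norm (r *\<^sub>R u + s *\<^sub>R v)"
      by (simp add: dist_norm algebra_simps)
    also have "\<dots> \<le> norm (r *\<^sub>R u) + norm (s *\<^sub>R v)"
      by (rule norm_triangle_ineq)
    also have "\<dots> \<le> t * norm u + t * norm v"
      using that by (intro add_mono) (auto intro: mult_right_mono)
    finally show ?thesis by (simp add: algebra_simps)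
  qed
  have d: "((\<lambda>r. f (x + r *\<^sub>R u + s *\<^sub>R v)) has_real_derivative
      frechet_derivative f (at (x + r *\<^sub>R u + s *\<^sub>R v)) u) (at r)"
    if "0 \<le> r" "r \<le> t" "0 \<le> s" "s \<le> t" for r s
  proof -
    have F: "(f has_derivative frechet_derivative f (at (x + r *\<^sub>R u + s *\<^sub>R v)))
        (at (x + r *\<^sub>R u + s *\<^sub>R v))"
      using f near that has_frechet_derivative by blast
    have "((\<lambda>r. x + r *\<^sub>R u + s *\<^sub>R v) has_derivative (\<lambda>h. h *\<^sub>R u)) (at r)"
      by (auto intro!: derivative_eq_intros)
    from has_derivative_compose[OF this F]
    show ?thesis
      unfolding has_field_derivative_def
      using linear_cmul[OF has_derivative_linear[OF F]] by (simp add: mult_commute_abs)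
  qed
  \<comment> \<open>The mean value theorem for \<open>r \<mapsto> f (x + r u + t v) - f (x + r u)\<close>.\<close>
  have "\<exists>r>0. r < t \<and> (f (x + t *\<^sub>R u + t *\<^sub>R v) - f (x + t *\<^sub>R u + 0 *\<^sub>R v)) -
      (f (x + 0 *\<^sub>R u + t *\<^sub>R v) - f (x + 0 *\<^sub>R u + 0 *\<^sub>R v)) = (t - 0) *
      (frechet_derivative f (at (x + r *\<^sub>R u + t *\<^sub>R v)) u
        - frechet_derivative f (at (x + r *\<^sub>R u + 0 *\<^sub>R v)) u)"
    using t by (intro MVT2 DERIV_diff d) auto
  then obtain r where r: "0 < r" "r < t"
    "f (x + t *\<^sub>R u + t *\<^sub>R v) - f (x + t *\<^sub>R u) - f (x + t *\<^sub>R v) + f x = t *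
      (frechet_derivative f (at (x + r *\<^sub>R u + t *\<^sub>R v)) u
        - frechet_derivative f (at (x + r *\<^sub>R u + 0 *\<^sub>R v)) u)"
    by (auto simp: algebra_simps)
  let ?g = "\<lambda>z. frechet_derivative f (at z) u"
  have d2: "((\<lambda>s. ?g (x + r *\<^sub>R u + s *\<^sub>R v)) has_real_derivative
      frechet_derivative ?g (at (x + r *\<^sub>R u + s *\<^sub>R v)) v) (at s)"
    if "0 \<le> s" "s \<le> t" for s
  proof -
    have F: "(?g has_derivative frechet_derivative ?g (at (x + r *\<^sub>R u + s *\<^sub>R v)))
        (at (x + r *\<^sub>R u + s *\<^sub>R v))"
      by (rule has_frechet_derivative[OF Df[OF near]]) (use r that in auto)
    have "((\<lambda>s. x + r *\<^sub>R u + s *\<^sub>R v) has_derivative (\<lambda>h. h *\<^sub>R v)) (at s)"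
      by (auto intro!: derivative_eq_intros)
    from has_derivative_compose[OF this F]
    show ?thesis
      unfolding has_field_derivative_def
      using linear_cmul[OF has_derivative_linear[OF F]] by (simp add: mult_commute_abs)
  qed
  have "\<exists>s>0. s < t \<and> ?g (x + r *\<^sub>R u + t *\<^sub>R v) - ?g (x + r *\<^sub>R u + 0 *\<^sub>R v) = (t - 0) *
      frechet_derivative ?g (at (x + r *\<^sub>R u + s *\<^sub>R v)) v"
    using t by (intro MVT2 d2) auto
  then obtain s where "0 < s" "s < t"
    "?g (x + r *\<^sub>R u + t *\<^sub>R v) - ?g (x + r *\<^sub>R u + 0 *\<^sub>R v) = t *
      frechet_derivative ?g (at (x + r *\<^sub>R u + s *\<^sub>R v)) v"
    by auto
  then show ?thesis
    using r near[of r s] by (intro exI[of _ "x + r *\<^sub>R u + s *\<^sub>R v"]) (auto simp: algebra_simps)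
qed

text \<open>Both mixed derivatives, at points arbitrarily close to \<open>x\<close>, equal the same second difference
  quotient. If they differed at \<open>x\<close>, continuity would keep them apart by a fixed amount nearby.\<close>

lemma smooth_on_second_derivative_commute:
  fixes f :: "'a::euclidean_space \<Rightarrow> real"
  assumes f: "smooth_on S f" and x: "x \<in> S"
  shows "frechet_derivative (\<lambda>z. frechet_derivative f (at z) u) (at x) v =
         frechet_derivative (\<lambda>z. frechet_derivative f (at z) v) (at x) u"
proof (rule ccontr)
  define D where "D u v z = frechet_derivative (\<lambda>z. frechet_derivative f (at z) u) (at z) v" for u v z
  assume "\<not> ?thesis"
  then have e: "\<bar>D u v x - D v u x\<bar> / 2 > 0" (is "?e > 0") by (simp add: D_def)
  have "\<exists>d>0. \<forall>z. dist z x < d \<longrightarrow> z \<in> S \<and> dist (D u v z) (D u v x) < ?e" for u v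
  proof -
    have "continuous_on S (D u v)"
      unfolding D_def by (intro smooth_on_continuous_on smooth_on_frechet_derivative f)
    then obtain d where d: "d > 0" "\<forall>z\<in>S. dist z x < d \<longrightarrow> dist (D u v z) (D u v x) < ?e"
      using x e unfolding continuous_on_iff by blast
    obtain d' where "d' > 0" "ball x d' \<subseteq> S"
      using smooth_on_imp_open[OF f] x openE by blast
    with d show ?thesis
      by (intro exI[of _ "min d d'"]) (auto simp: subset_iff dist_commute)
  qed
  then obtain d1 d2 where d: "d1 > 0" "d2 > 0"
    "\<And>z. dist z x < d1 \<Longrightarrow> z \<in> S \<and> dist (D u v z) (D u v x) < ?e"
    "\<And>z. dist z x < d2 \<Longrightarrow> z \<in> S \<and> dist (D v u z) (D v u x) < ?e" by meson
  \<comment> \<open>Small enough for the parallelogram spanned by \<open>t u\<close> and \<open>t v\<close> to stay within both radii; the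
    summand 1 covers the case \<open>u = v = 0\<close>.\<close>
  define t where "t = min d1 d2 / (2 * (norm u + norm v + 1))"
  have n: "norm u + norm v + 1 > 0" using norm_ge_zero[of u] norm_ge_zero[of v] by linarith
  have t: "t > 0" using d n by (auto simp: t_def)
  have "t * (norm u + norm v) \<le> t * (norm u + norm v + 1)" using t by simp
  also have "\<dots> = min d1 d2 / 2" using n by (simp add: t_def field_simps)
  also have "\<dots> < min d1 d2" using d by auto
  finally have t2: "t * (norm u + norm v) < min d1 d2" .
  have S: "z \<in> S" if "dist z x \<le> t * (norm u + norm v)" for z
    using d(3)[of z] that t2 by auto
  obtain z where z: "dist z x \<le> t * (norm u + norm v)"
    "f (x + t *\<^sub>R u + t *\<^sub>R v) - f (x + t *\<^sub>R u) - f (x + t *\<^sub>R v) + f x = t * t * D u v z"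
    unfolding D_def
    using second_difference_mvt[OF t, of x u v f] S
      smooth_on_differentiable[OF f] smooth_on_differentiable[OF smooth_on_frechet_derivative[OF f]]
    by meson
  obtain z' where z': "dist z' x \<le> t * (norm v + norm u)"
    "f (x + t *\<^sub>R v + t *\<^sub>R u) - f (x + t *\<^sub>R v) - f (x + t *\<^sub>R u) + f x = t * t * D v u z'"
    unfolding D_def
    using second_difference_mvt[OF t, of x v u f] S
      smooth_on_differentiable[OF f] smooth_on_differentiable[OF smooth_on_frechet_derivative[OF f]]
    by (metis add.commute)
  have "t * t * D u v z = t * t * D v u z'"
    using z(2) z'(2) by (simp only: add.assoc add.commute[of "t *\<^sub>R u" "t *\<^sub>R v"])
  then have "D u v z = D v u z'" using t by simp
  moreover have "dist (D u v z) (D u v x) < ?e" using d(3)[of z] z t2 by auto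
  moreover have "dist (D v u z') (D v u x) < ?e" using d(4)[of z'] z' t2 by (auto simp: add.commute)
  moreover have "\<bar>D u v x - D v u x\<bar> \<le> dist (D u v z) (D u v x) + dist (D u v z) (D v u x)"
    by (metis dist_commute dist_real_def dist_triangle)
  ultimately show False by simp
qed

section \<open>Determinants\<close>

text \<open>Jacobi's formula \<open>d (det M) = det M \<cdot> tr (dM \<cdot> M\<^sup>-\<^sup>1)\<close>. The product rule gives the sum over \<open>i\<close> of
  the determinants in which row \<open>i\<close> of \<open>M\<close> is replaced by row \<open>i\<close> of \<open>dM\<close>. As \<open>dM = (dM \<cdot> K) M\<close>, that
  row is a combination of the rows of \<open>M\<close>, and only its \<open>i\<close>-th coefficient contributes.\<close>

lemma has_derivative_det:
  fixes M M' :: "'a::euclidean_space \<Rightarrow> real ^ 'n::finite ^ 'n"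
  assumes M: "\<And>i j. ((\<lambda>z. M z $ i $ j) has_derivative (\<lambda>v. M' v $ i $ j)) (at x)"
    and inv: "K ** M x = mat 1"
  shows "((\<lambda>z. det (M z)) has_derivative
    (\<lambda>v. det (M x) * (\<Sum>i\<in>UNIV. \<Sum>k\<in>UNIV. M' v $ i $ k * K $ k $ i))) (at x)"
proof -
  have row: "(\<Sum>p | p permutes UNIV. of_int (sign p) * (M' v $ i $ p i * (\<Prod>j\<in>UNIV - {i}. M x $ j $ p j)))
      = (\<Sum>k\<in>UNIV. M' v $ i $ k * K $ k $ i) * det (M x)" for v i
  proof -
    have "M' v = (M' v ** K) ** M x" by (simp add: inv matrix_mul_assoc[symmetric])
    moreover have "row i (C ** N) = (\<Sum>l\<in>UNIV. C $ i $ l *s row l N)" for C N :: "real ^ 'n ^ 'n"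
      by (simp add: vec_eq_iff row_def matrix_matrix_mult_def)
    ultimately have r: "row i (M' v) = (\<Sum>l\<in>UNIV. (M' v ** K) $ i $ l *s row l (M x))"
      by metis
    have s: "(\<Sum>p | p permutes UNIV. of_int (sign p) * (M' v $ i $ p i * (\<Prod>j\<in>UNIV - {i}. M x $ j $ p j)))
        = det (\<chi> l. if l = i then row i (M' v) else row l (M x))"
      unfolding det_def
    proof (rule sum.cong[OF refl])
      fix p
      have "(\<Prod>l\<in>UNIV. (\<chi> l. if l = i then row i (M' v) else row l (M x)) $ l $ p l)
          = M' v $ i $ p i * (\<Prod>j\<in>UNIV - {i}. M x $ j $ p j)"
        by (subst prod.remove[of _ i]) (auto simp: row_def intro!: prod.cong)
      then show "of_int (sign p) * (M' v $ i $ p i * (\<Prod>j\<in>UNIV - {i}. M x $ j $ p j)) =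
        of_int (sign p) * (\<Prod>l\<in>UNIV. (\<chi> l. if l = i then row i (M' v) else row l (M x)) $ l $ p l)"
        by simp
    qed
    show ?thesis
      unfolding s r cramer_lemma_transpose by (simp add: matrix_matrix_mult_def)
  qed
  have "((\<lambda>z. det (M z)) has_derivative
    (\<lambda>v. \<Sum>p | p permutes UNIV. of_int (sign p) *
      (\<Sum>i\<in>UNIV. M' v $ i $ p i * (\<Prod>j\<in>UNIV - {i}. M x $ j $ p j)))) (at x)"
    unfolding det_def
    by (intro has_derivative_sum has_derivative_mult_right has_derivative_prod M)
  moreover have "(\<Sum>p | p permutes UNIV. of_int (sign p) *
      (\<Sum>i\<in>UNIV. M' v $ i $ p i * (\<Prod>j\<in>UNIV - {i}. M x $ j $ p j)))
      = det (M x) * (\<Sum>i\<in>UNIV. \<Sum>k\<in>UNIV. M' v $ i $ k * K $ k $ i)" for v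
    by (simp add: sum_distrib_left, subst sum.swap) (simp add: row sum_distrib_left[symmetric] sum_distrib_right[symmetric] mult.commute)
  ultimately show ?thesis by simp
qed

text \<open>Along the segment from the identity to \<open>G\<close> all matrices are positive definite, hence
  nonsingular, so the determinant cannot change sign.\<close>

lemma det_pos_def_pos:
  fixes G :: "real ^ 'n::finite ^ 'n"
  assumes "\<And>v. v \<noteq> 0 \<Longrightarrow> v \<bullet> (G *v v) > 0"
  shows "det G > 0"
proof -
  define h where "h t = det (t *\<^sub>R G + (1 - t) *\<^sub>R mat 1)" for t
  have nz: "h t \<noteq> 0" if "0 \<le> t" "t \<le> 1" for t
  proof
    assume "h t = 0"
    then obtain v where v: "v \<noteq> 0" "(t *\<^sub>R G + (1 - t) *\<^sub>R mat 1) *v v = 0"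
      unfolding h_def
      using det_nz_iff_inj_gen matrix_left_invertible_ker invertible_left_inverse invertible_det_nz
      by metis
    have "0 = t * (v \<bullet> (G *v v)) + (1 - t) * (v \<bullet> v)"
      using v(2) by (metis (no_types, lifting) inner_zero_right inner_add_right inner_scaleR_right
          matrix_vector_mult_add_rdistrib scaleR_matrix_vector_assoc matrix_vector_mul_lid)
    moreover have "v \<bullet> (G *v v) > 0" "v \<bullet> v > 0" using assms v(1) by auto
    ultimately show False
      using that
      by (smt (verit) mult_nonneg_nonneg mult_pos_pos)
  qed
  have cont: "continuous_on {0..1} h"
    unfolding h_def det_def by (intro continuous_intros continuous_on_prod') 
  have "h 0 = 1" "h 1 = det G" by (simp_all add: h_def)
  show ?thesis
  proof (rule ccontr)
    assume "\<not> det G > 0"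
    then have "\<exists>t\<ge>0. t \<le> 1 \<and> h t = 0"
      using cont \<open>h 0 = 1\<close> \<open>h 1 = det G\<close> by (intro IVT2') auto
    then show False using nz by blast
  qed
qed

section \<open>Differential operators in coordinates\<close>

definition partials :: "(real ^ 'n::finite \<Rightarrow> real) \<Rightarrow> real ^ 'n \<Rightarrow> real ^ 'n" where
  "partials u z = (\<chi> i. frechet_derivative u (at z) (axis i 1))"

text \<open>The Riemannian divergence in coordinates, when \<open>w\<close> is the volume density.\<close>

definition coord_div ::
    "(real ^ 'n::finite \<Rightarrow> real) \<Rightarrow> (real ^ 'n \<Rightarrow> real ^ 'n) \<Rightarrow> real ^ 'n \<Rightarrow> real" where
  "coord_div w V z = (\<Sum>i\<in>UNIV. partials (\<lambda>y. w y * V y $ i) z $ i) / w z"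

definition coord_grad ::
    "(real ^ 'n::finite \<Rightarrow> real ^ 'n ^ 'n) \<Rightarrow> (real ^ 'n \<Rightarrow> real) \<Rightarrow> real ^ 'n \<Rightarrow> real ^ 'n" where
  "coord_grad G u z = matrix_inv (G z) *v partials u z"

definition coord_generator ::
    "(real ^ 'n::finite \<Rightarrow> real ^ 'n ^ 'n) \<Rightarrow> (real ^ 'n \<Rightarrow> real) \<Rightarrow> (real ^ 'n \<Rightarrow> real) \<Rightarrow>
     real ^ 'n \<Rightarrow> real" where
  "coord_generator G h u z = (coord_div (\<lambda>y. sqrt (det (G y))) (coord_grad G u) z -
     coord_grad G h z \<bullet> (G z *v coord_grad G u z)) / 2"

text \<open>A Riemannian metric in coordinates: \<open>G z\<close> is its Gram matrix at the point with coordinates \<open>z\<close>.\<close>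

definition metric_on :: "(real ^ 'n::finite) set \<Rightarrow> (real ^ 'n \<Rightarrow> real ^ 'n ^ 'n) \<Rightarrow> bool" where
  "metric_on S G \<longleftrightarrow> open S \<and> (\<forall>i j. smooth_on S (\<lambda>z. G z $ i $ j)) \<and>
     (\<forall>z\<in>S. transpose (G z) = G z \<and> (\<forall>v. v \<noteq> 0 \<longrightarrow> v \<bullet> (G z *v v) > 0))"

lemma smooth_on_partials: "smooth_on S u \<Longrightarrow> smooth_on S (\<lambda>z. partials u z $ i)"
  by (simp add: partials_def smooth_on_frechet_derivative)

lemma smooth_on_component:
  fixes \<phi> :: "'a::euclidean_space \<Rightarrow> real ^ 'n::finite"
  assumes "smooth_on S \<phi>"
  shows "smooth_on S (\<lambda>z. \<phi> z $ k)"
proof -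
  have "times_cont_diff_on m S (\<lambda>z. \<phi> z $ k)" if "times_cont_diff_on m S \<phi>" for m
    using that
  proof (induction m arbitrary: \<phi>)
    case 0
    then show ?case by (simp add: continuous_on_component)
  next
    case (Suc m)
    have D: "((\<lambda>z. \<phi> z $ k) has_derivative (\<lambda>v. frechet_derivative \<phi> (at x) v $ k)) (at x)"
      if "x \<in> S" for x
      by (intro bounded_linear.has_derivative[OF bounded_linear_vec_nth]
          has_frechet_derivative times_cont_diff_on_SucD(1)[OF Suc.prems that])
    have "times_cont_diff_on m S (\<lambda>x. frechet_derivative (\<lambda>z. \<phi> z $ k) (at x) v)" for v
      by (rule times_cont_diff_on_cong[OF smooth_on_imp_open[OF assms]
            frechet_derivative_eqI[OF D, symmetric] Suc.IH[OF times_cont_diff_on_SucD(2)[OF Suc.prems]]])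
    then show ?case using D by (auto simp: differentiable_def)
  qed
  then show ?thesis using assms by (simp add: smooth_on_def)
qed

lemma partials_cong:
  assumes "smooth_on S u" "z \<in> S" "\<And>y. y \<in> S \<Longrightarrow> u y = u' y"
  shows "partials u z = partials u' z"
  using frechet_derivative_transform_within_open[OF smooth_on_differentiable[OF assms(1,2)]
      smooth_on_imp_open[OF assms(1)] assms(2,3)]
  by (simp add: partials_def)

lemma partials_mult:
  assumes "u differentiable (at z)" "v differentiable (at z)"
  shows "partials (\<lambda>y. u y * v y) z = u z *\<^sub>R partials v z + v z *\<^sub>R partials u z"
  using frechet_derivative_eqI[OF has_derivative_mult[OF has_frechet_derivative[OF assms(1)] has_frechet_derivative[OF assms(2)]]]
  by (simp add: partials_def vec_eq_iff)

lemma partials_add: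
  assumes "u differentiable (at z)" "v differentiable (at z)"
  shows "partials (\<lambda>y. u y + v y) z = partials u z + partials v z"
  using frechet_derivative_eqI[OF has_derivative_add[OF has_frechet_derivative[OF assms(1)] has_frechet_derivative[OF assms(2)]]]
  by (simp add: partials_def vec_eq_iff)

lemma partials_sum:
  assumes "\<And>i. i \<in> I \<Longrightarrow> u i differentiable (at z)"
  shows "partials (\<lambda>y. \<Sum>i\<in>I. u i y) z = (\<Sum>i\<in>I. partials (u i) z)"
  using frechet_derivative_eqI[OF has_derivative_sum[of I u, OF has_frechet_derivative[OF assms]]]
  by (simp add: partials_def vec_eq_iff)

lemma jacobian_nth:
  fixes \<phi> :: "real ^ 'n::finite \<Rightarrow> real ^ 'n"
  assumes "\<phi> differentiable (at z)"
  shows "jacobian \<phi> (at z) $ k $ i = partials (\<lambda>y. \<phi> y $ k) z $ i"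
  using frechet_derivative_eqI[OF bounded_linear.has_derivative[OF bounded_linear_vec_nth has_frechet_derivative[OF assms]]]
  by (simp add: partials_def jacobian_def matrix_def)

lemma partials_compose:
  fixes \<phi> :: "real ^ 'n::finite \<Rightarrow> real ^ 'n"
  assumes "\<phi> differentiable (at z)" "u differentiable (at (\<phi> z))"
  shows "partials (\<lambda>y. u (\<phi> y)) z = transpose (jacobian \<phi> (at z)) *v partials u (\<phi> z)"
proof -
  have lin: "linear (frechet_derivative u (at (\<phi> z)))"
    using assms(2) by (rule linear_frechet_derivative)
  have "frechet_derivative (\<lambda>y. u (\<phi> y)) (at z) (axis i 1) =
      (\<Sum>l\<in>UNIV. jacobian \<phi> (at z) $ l $ i * frechet_derivative u (at (\<phi> z)) (axis l 1))" for i
  proof -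
    have "frechet_derivative (\<lambda>y. u (\<phi> y)) (at z) (axis i 1) =
        frechet_derivative u (at (\<phi> z)) (frechet_derivative \<phi> (at z) (axis i 1))"
      by (rule frechet_derivative_eqI[OF has_derivative_compose[OF has_frechet_derivative[OF assms(1)]
            has_frechet_derivative[OF assms(2)]]])
    also have "frechet_derivative \<phi> (at z) (axis i 1) = (\<Sum>l\<in>UNIV. jacobian \<phi> (at z) $ l $ i *\<^sub>R axis l 1)"
      by (simp add: vec_eq_iff jacobian_def matrix_def axis_def if_distrib[of "\<lambda>x. _ * x"] cong: if_cong)
    finally show ?thesis
      by (simp add: linear_sum[OF lin] linear_cmul[OF lin])
  qed
  then show ?thesis
    by (simp add: vec_eq_iff partials_def matrix_vector_mult_def transpose_def)
qed

section \<open>Invariance of the divergence\<close>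

text \<open>The divergence splits into the Euclidean one and the logarithmic derivative of the density
  along the field.\<close>

lemma coord_div_expand:
  fixes w :: "real ^ 'n::finite \<Rightarrow> real"
  assumes "w differentiable (at z)" "\<And>i. (\<lambda>y. V y $ i) differentiable (at z)" "w z \<noteq> 0"
  shows "coord_div w V z =
    (\<Sum>i\<in>UNIV. partials (\<lambda>y. V y $ i) z $ i) + (partials w z \<bullet> V z) / w z"
  using assms
  by (simp add: coord_div_def partials_mult sum.distrib inner_vec_def mult.commute add_divide_distrib
      sum_distrib_left[symmetric])

text \<open>With \<open>J\<close> the Jacobian matrix of \<open>\<phi>\<close> and \<open>K\<close> its inverse at \<open>z\<close>, differentiating the law
  \<open>w\<^sup>2 = (det J)\<^sup>2 (w' \<circ> \<phi>)\<^sup>2\<close> gives, by Jacobi's formula,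
  \<open>\<partial>\<^sub>i w / w = T\<^sub>i + \<partial>\<^sub>i (w' \<circ> \<phi>) / (w' \<circ> \<phi>)\<close> with \<open>T\<^sub>i = tr (\<partial>\<^sub>i J \<cdot> K)\<close>. Squared densities avoid the absolute value
  of \<open>det J\<close>. Differentiating \<open>J V = V' \<circ> \<phi>\<close> and contracting with \<open>K\<close> shows that the Euclidean
  divergences of \<open>V\<close> and \<open>V'\<close> differ by the same \<open>\<Sum>\<^sub>i T\<^sub>i V\<^sub>i\<close>, with the opposite sign, because
  \<open>\<partial>\<^sub>i J\<^sub>k\<^sub>m = \<partial>\<^sub>m J\<^sub>k\<^sub>i\<close>. The inverse matrix never has to be differentiated.\<close>

lemma coord_div_invariant:
  fixes \<phi> :: "real ^ 'n::finite \<Rightarrow> real ^ 'n"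
  assumes z: "z \<in> S" and \<phi>: "smooth_on S \<phi>"
    and w: "smooth_on S w" and V: "\<And>i. smooth_on S (\<lambda>y. V y $ i)"
    and w': "w' differentiable (at (\<phi> z))" and V': "\<And>i. (\<lambda>y. V' y $ i) differentiable (at (\<phi> z))"
    and det: "det (jacobian \<phi> (at z)) \<noteq> 0" and w_nz: "w z \<noteq> 0"
    and ww': "\<And>y. y \<in> S \<Longrightarrow> (w y)\<^sup>2 = (det (jacobian \<phi> (at y)))\<^sup>2 * (w' (\<phi> y))\<^sup>2"
    and VV': "\<And>y. y \<in> S \<Longrightarrow> jacobian \<phi> (at y) *v V y = V' (\<phi> y)"
  shows "coord_div w V z = coord_div w' V' (\<phi> z)"
proof -
  note diff = smooth_on_differentiable[OF _ z]
  define J where "J y = jacobian \<phi> (at y)" for y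
  define dJ where "dJ i k m = partials (\<lambda>y. J y $ k $ m) z $ i" for i k m
  define dV where "dV i k = partials (\<lambda>y. V y $ k) z $ i" for i k
  define d where "d y = det (J y)" for y
  have \<phi>_k: "smooth_on S (\<lambda>y. \<phi> y $ k)" for k
    by (rule smooth_on_component[OF \<phi>])
  have J_eq: "J y $ k $ m = partials (\<lambda>y. \<phi> y $ k) y $ m" if "y \<in> S" for y k m
    unfolding J_def by (rule jacobian_nth[OF smooth_on_differentiable[OF \<phi> that]])
  have J_smooth: "smooth_on S (\<lambda>y. J y $ k $ m)" for k m
    by (rule smooth_on_cong[OF smooth_on_partials[OF \<phi>_k]]) (simp add: J_eq)
  have d_smooth: "smooth_on S d"
    unfolding d_def by (intro smooth_on_det smooth_on_imp_open[OF \<phi>] J_smooth)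
  have sym: "dJ i k m = dJ m k i" for i k m
  proof -
    have "dJ i k m = partials (\<lambda>y. partials (\<lambda>y. \<phi> y $ k) y $ m) z $ i" for i m
      unfolding dJ_def by (subst partials_cong[OF J_smooth z J_eq]) auto
    then show ?thesis
      using smooth_on_second_derivative_commute[OF \<phi>_k z] by (simp add: partials_def)
  qed
  have dz: "d z \<noteq> 0" using det by (simp add: d_def J_def)
  then obtain K where K: "K ** J z = mat 1" "J z ** K = mat 1"
    unfolding d_def invertible_det_nz[symmetric] invertible_def by blast
  have KJ: "(\<Sum>k\<in>UNIV. K $ m $ k * J z $ k $ i) = (if m = i then 1 else 0)" for m i
    using K(1) by (simp add: vec_eq_iff matrix_matrix_mult_def mat_def)
  have JK: "(\<Sum>m\<in>UNIV. J z $ l $ m * K $ m $ k) = (if l = k then 1 else 0)" for l k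
    using K(2) by (simp add: vec_eq_iff matrix_matrix_mult_def mat_def)
  \<comment> \<open>The logarithmic derivative of \<open>det J\<close> in direction \<open>i\<close>.\<close>
  define T where "T i = (\<Sum>k\<in>UNIV. \<Sum>m\<in>UNIV. dJ i k m * K $ m $ k)" for i
  have dd: "partials d z $ i = d z * T i" for i
  proof -
    let ?M' = "\<lambda>v. \<chi> k m. frechet_derivative (\<lambda>y. J y $ k $ m) (at z) v"
    have "(d has_derivative (\<lambda>v. det (J z) * (\<Sum>i\<in>UNIV. \<Sum>k\<in>UNIV. ?M' v $ i $ k * K $ k $ i))) (at z)"
      unfolding d_def
      by (rule has_derivative_det[where M = J and K = K, OF _ K(1)]) (simp add: has_frechet_derivative[OF diff[OF J_smooth]])
    from frechet_derivative_eqI[OF this] show ?thesis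
      by (simp add: partials_def T_def dJ_def d_def)
  qed
  have \<phi>z: "\<phi> differentiable (at z)" by (rule diff[OF \<phi>])
  have w'\<phi>: "(\<lambda>y. w' (\<phi> y)) differentiable (at z)"
    using differentiable_chain_at[OF \<phi>z w'] by (simp add: o_def)
  have w'_nz: "w' (\<phi> z) \<noteq> 0" using ww'[OF z] w_nz by auto
  have dw: "partials w z $ i / w z = T i +
      (transpose (J z) *v partials w' (\<phi> z)) $ i / w' (\<phi> z)" for i
  proof -
    let ?q = "\<lambda>y. d y * w' (\<phi> y)"
    have q: "?q differentiable (at z)" using diff[OF d_smooth] w'\<phi> by (rule differentiable_mult)
    have wz: "w differentiable (at z)" by (rule diff[OF w])
    have "partials (\<lambda>y. w y * w y) z = partials (\<lambda>y. ?q y * ?q y) z"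
      using ww' by (intro partials_cong[OF smooth_on_mult[OF w w] z])
        (simp add: d_def J_def power2_eq_square)
    then have "w z * partials w z $ i = ?q z * partials ?q z $ i"
      using wz q by (simp add: partials_mult vec_eq_iff)
    also have "partials ?q z $ i = d z * (transpose (J z) *v partials w' (\<phi> z)) $ i + w' (\<phi> z) * (d z * T i)"
      using w'\<phi> diff[OF d_smooth] w' \<phi>z by (simp add: partials_mult partials_compose J_def dd)
    finally have "w z * partials w z $ i = (?q z)\<^sup>2 *
        (T i + (transpose (J z) *v partials w' (\<phi> z)) $ i / w' (\<phi> z))"
      using w'_nz by (simp add: power2_eq_square field_simps)
    also have "(?q z)\<^sup>2 = (w z)\<^sup>2"
      using ww'[OF z] by (simp add: d_def J_def power_mult_distrib)
    finally have "w z * partials w z $ i = w z * (w z *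
        (T i + (transpose (J z) *v partials w' (\<phi> z)) $ i / w' (\<phi> z)))"
      by (simp only: power2_eq_square mult.assoc)
    then have "partials w z $ i = w z *
        (T i + (transpose (J z) *v partials w' (\<phi> z)) $ i / w' (\<phi> z))"
      by (rule iffD1[OF mult_left_cancel[OF w_nz]])
    then show ?thesis
      using w_nz by (simp only: nonzero_mult_div_cancel_left[OF w_nz])
  qed
  \<comment> \<open>The derivative in direction \<open>m\<close> of component \<open>k\<close> of \<open>J V = V' \<circ> \<phi>\<close>. The three sums are next
    contracted with \<open>K\<close> over \<open>m\<close> and \<open>k\<close>: the right-hand side and the second summand become Euclidean
    divergences, the first summand becomes \<open>\<Sum>\<^sub>i T\<^sub>i V\<^sub>i\<close>.\<close>
  have dV': "(\<Sum>i\<in>UNIV. dJ m k i * V z $ i) + (\<Sum>i\<in>UNIV. J z $ k $ i * dV m i) =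
      (\<Sum>l\<in>UNIV. J z $ l $ m * partials (\<lambda>y. V' y $ k) (\<phi> z) $ l)" for m k
  proof -
    have "partials (\<lambda>y. \<Sum>i\<in>UNIV. J y $ k $ i * V y $ i) z = partials (\<lambda>y. V' (\<phi> y) $ k) z"
      by (rule partials_cong[OF smooth_on_sum[OF smooth_on_imp_open[OF \<phi>] smooth_on_mult[OF J_smooth V]] z])
        (simp add: VV'[symmetric] J_def matrix_vector_mult_def)
    also have "\<dots> = transpose (J z) *v partials (\<lambda>y. V' y $ k) (\<phi> z)"
      unfolding J_def by (rule partials_compose[OF \<phi>z V'])
    also have "partials (\<lambda>y. \<Sum>i\<in>UNIV. J y $ k $ i * V y $ i) z =
        (\<Sum>i\<in>UNIV. J z $ k $ i *\<^sub>R partials (\<lambda>y. V y $ i) z + V z $ i *\<^sub>R partials (\<lambda>y. J y $ k $ i) z)"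
      using diff[OF J_smooth] diff[OF V] by (subst partials_sum) (auto simp: partials_mult intro: differentiable_mult)
    finally have "(\<Sum>i\<in>UNIV. J z $ k $ i *\<^sub>R partials (\<lambda>y. V y $ i) z + V z $ i *\<^sub>R partials (\<lambda>y. J y $ k $ i) z) $ m
       = (transpose (J z) *v partials (\<lambda>y. V' y $ k) (\<phi> z)) $ m" by simp
    then show ?thesis
      by (simp add: dJ_def dV_def matrix_vector_mult_def transpose_def sum.distrib mult.commute add.commute)
  qed
  have "(\<Sum>m\<in>UNIV. \<Sum>k\<in>UNIV. K $ m $ k * (\<Sum>l\<in>UNIV. J z $ l $ m * partials (\<lambda>y. V' y $ k) (\<phi> z) $ l))
      = (\<Sum>k\<in>UNIV. \<Sum>m\<in>UNIV. \<Sum>l\<in>UNIV. J z $ l $ m * K $ m $ k * partials (\<lambda>y. V' y $ k) (\<phi> z) $ l)"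
    by (subst sum.swap) (simp add: sum_distrib_left algebra_simps)
  also have "\<dots> = (\<Sum>k\<in>UNIV. \<Sum>l\<in>UNIV. (\<Sum>m\<in>UNIV. J z $ l $ m * K $ m $ k) * partials (\<lambda>y. V' y $ k) (\<phi> z) $ l)"
    by (rule sum.cong[OF refl], subst sum.swap) (simp add: sum_distrib_right)
  also have "\<dots> = (\<Sum>k\<in>UNIV. partials (\<lambda>y. V' y $ k) (\<phi> z) $ k)"
    by (simp add: JK if_distrib[of "\<lambda>x. x * _"] cong: if_cong)
  finally have R: "(\<Sum>m\<in>UNIV. \<Sum>k\<in>UNIV. K $ m $ k * (\<Sum>l\<in>UNIV. J z $ l $ m * partials (\<lambda>y. V' y $ k) (\<phi> z) $ l))
      = (\<Sum>k\<in>UNIV. partials (\<lambda>y. V' y $ k) (\<phi> z) $ k)" .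
  have "(\<Sum>m\<in>UNIV. \<Sum>k\<in>UNIV. K $ m $ k * (\<Sum>i\<in>UNIV. J z $ k $ i * dV m i))
      = (\<Sum>m\<in>UNIV. \<Sum>i\<in>UNIV. (\<Sum>k\<in>UNIV. K $ m $ k * J z $ k $ i) * dV m i)"
    by (simp add: sum_distrib_left sum_distrib_right mult.assoc, rule sum.cong[OF refl], rule sum.swap)
  also have "\<dots> = (\<Sum>m\<in>UNIV. dV m m)"
    by (simp add: KJ if_distrib[of "\<lambda>x. x * _"] cong: if_cong)
  finally have L: "(\<Sum>m\<in>UNIV. \<Sum>k\<in>UNIV. K $ m $ k * (\<Sum>i\<in>UNIV. J z $ k $ i * dV m i)) = (\<Sum>m\<in>UNIV. dV m m)" .
  have "(\<Sum>m\<in>UNIV. \<Sum>k\<in>UNIV. K $ m $ k * (\<Sum>i\<in>UNIV. dJ m k i * V z $ i))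
      = (\<Sum>m\<in>UNIV. \<Sum>k\<in>UNIV. \<Sum>i\<in>UNIV. dJ i k m * K $ m $ k * V z $ i)"
    unfolding sum_distrib_left
  proof (intro sum.cong refl)
    show "K $ m $ k * (dJ m k i * V z $ i) = dJ i k m * K $ m $ k * V z $ i" for m k i
      by (simp add: sym[of i k m])
  qed
  also have "\<dots> = (\<Sum>k\<in>UNIV. \<Sum>m\<in>UNIV. \<Sum>i\<in>UNIV. dJ i k m * K $ m $ k * V z $ i)"
    by (rule sum.swap)
  also have "\<dots> = (\<Sum>k\<in>UNIV. \<Sum>i\<in>UNIV. \<Sum>m\<in>UNIV. dJ i k m * K $ m $ k * V z $ i)"
    by (rule sum.cong[OF refl], rule sum.swap)
  also have "\<dots> = (\<Sum>i\<in>UNIV. \<Sum>k\<in>UNIV. \<Sum>m\<in>UNIV. dJ i k m * K $ m $ k * V z $ i)"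
    by (rule sum.swap)
  also have "\<dots> = (\<Sum>i\<in>UNIV. T i * V z $ i)"
    by (simp add: T_def sum_distrib_right)
  finally have C: "(\<Sum>m\<in>UNIV. \<Sum>k\<in>UNIV. K $ m $ k * (\<Sum>i\<in>UNIV. dJ m k i * V z $ i)) = (\<Sum>i\<in>UNIV. T i * V z $ i)" .
  have main: "(\<Sum>i\<in>UNIV. T i * V z $ i) + (\<Sum>m\<in>UNIV. dV m m) = (\<Sum>k\<in>UNIV. partials (\<lambda>y. V' y $ k) (\<phi> z) $ k)"
    unfolding R[symmetric] C[symmetric] L[symmetric] dV'[symmetric]
    by (simp add: distrib_left sum.distrib)
  have "(partials w z \<bullet> V z) / w z = (\<Sum>i\<in>UNIV. (partials w z $ i / w z) * V z $ i)"
    by (simp add: inner_vec_def sum_divide_distrib)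
  also have "\<dots> = (\<Sum>i\<in>UNIV. T i * V z $ i) + ((transpose (J z) *v partials w' (\<phi> z)) \<bullet> V z) / w' (\<phi> z)"
    unfolding dw by (simp add: inner_vec_def sum_divide_distrib distrib_right sum.distrib)
  also have "(transpose (J z) *v partials w' (\<phi> z)) \<bullet> V z = partials w' (\<phi> z) \<bullet> V' (\<phi> z)"
    using VV'[OF z] by (metis J_def dot_lmul_matrix vector_transpose_matrix transpose_matrix_vector)
  finally show ?thesis
    using main diff[OF w] diff[OF V] w_nz w' V' w'_nz
    by (simp add: coord_div_expand dV_def)
qed

section \<open>The generator in coordinates\<close>

lemma metric_on_open: "metric_on S G \<Longrightarrow> open S"
  by (simp add: metric_on_def)

lemma metric_on_det_pos:
  assumes "metric_on S G" "z \<in> S"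
  shows "det (G z) > 0"
  using assms by (intro det_pos_def_pos) (auto simp: metric_on_def)

lemma metric_on_symmetric:
  assumes "metric_on S G" "z \<in> S"
  shows "(G z *v a) \<bullet> b = a \<bullet> (G z *v b)"
  using assms by (metis metric_on_def dot_lmul_matrix transpose_matrix_vector)

lemma metric_on_coord_grad:
  assumes "metric_on S G" "z \<in> S"
  shows "G z *v coord_grad G u z = partials u z"
proof -
  have "invertible (G z)"
    using metric_on_det_pos[OF assms] by (simp add: invertible_det_nz)
  then have "G z ** matrix_inv (G z) = mat 1" 
    unfolding invertible_def matrix_inv_def by (rule someI2_ex) simp
  then show ?thesis by (simp add: coord_grad_def matrix_vector_mul_assoc)
qed

text \<open>By Cramer's rule the components of the gradient are rational functions of the entries of \<open>G\<close>
  and the partial derivatives of \<open>u\<close>.\<close>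

lemma smooth_on_coord_grad:
  assumes G: "metric_on S G" and u: "smooth_on S u"
  shows "smooth_on S (\<lambda>z. coord_grad G u z $ k)"
proof (rule smooth_on_cong)
  have "smooth_on S (\<lambda>z. (\<chi> i j. if j = k then partials u z $ i else G z $ i $ j) $ i $ j)" for i j
    using G smooth_on_partials[OF u] by (cases "j = k") (auto simp: metric_on_def)
  then show "smooth_on S (\<lambda>z. det (\<chi> i j. if j = k then partials u z $ i else G z $ i $ j) / det (G z))"
    using G metric_on_det_pos[OF G]
    by (intro smooth_on_divide smooth_on_det) (auto simp: metric_on_def less_imp_neq[THEN not_sym])
next
  fix z assume z: "z \<in> S"
  then show "det (\<chi> i j. if j = k then partials u z $ i else G z $ i $ j) / det (G z) = coord_grad G u z $ k"
    using cramer[of "G z" "coord_grad G u z" "partials u z"] metric_on_det_pos[OF G z] metric_on_coord_grad[OF G z]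
    by auto
qed

lemma smooth_on_sqrt_det:
  assumes G: "metric_on S G"
  shows "smooth_on S (\<lambda>z. sqrt (det (G z)))"
  using G metric_on_det_pos[OF G] by (intro smooth_on_sqrt smooth_on_det) (auto simp: metric_on_def)

text \<open>The generator is assembled from smooth functions by arithmetic and differentiation, once
  \<open>G (coord_grad G u)\<close> is recognised as the differential of \<open>u\<close>.\<close>

lemma smooth_on_coord_generator:
  assumes G: "metric_on S G" and h: "smooth_on S h" and u: "smooth_on S u"
  shows "smooth_on S (coord_generator G h u)"
proof (rule smooth_on_cong)
  show "smooth_on S (\<lambda>z. ((\<Sum>i\<in>UNIV. partials (\<lambda>y. sqrt (det (G y)) * coord_grad G u y $ i) z $ i) / sqrt (det (G z))
      + -1 * (\<Sum>i\<in>UNIV. coord_grad G h z $ i * partials u z $ i)) / 2)"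
    using metric_on_det_pos[OF G]
    by (intro smooth_on_divide smooth_on_add smooth_on_mult smooth_on_sum smooth_on_const
        smooth_on_partials smooth_on_sqrt_det[OF G] smooth_on_coord_grad[OF G] h u metric_on_open[OF G])
      (auto simp: less_imp_neq[THEN not_sym])
next
  fix z assume "z \<in> S"
  then show "((\<Sum>i\<in>UNIV. partials (\<lambda>y. sqrt (det (G y)) * coord_grad G u y $ i) z $ i) / sqrt (det (G z))
      + -1 * (\<Sum>i\<in>UNIV. coord_grad G h z $ i * partials u z $ i)) / 2 = coord_generator G h u z"
    by (simp add: coord_generator_def coord_div_def metric_on_coord_grad[OF G] inner_vec_def)
qed

lemma coord_grad_mult:
  assumes "u differentiable (at z)" "v differentiable (at z)"
  shows "coord_grad G (\<lambda>y. u y * v y) z = u z *\<^sub>R coord_grad G v z + v z *\<^sub>R coord_grad G u z"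
  by (simp add: coord_grad_def partials_mult[OF assms] matrix_vector_right_distrib matrix_vector_mult_scaleR)

text \<open>The product rule of a second order operator: the correction to the Leibniz rule is the
  carre du champ, the inner product of the two gradients. It is produced twice by the divergence,
  and the factor \<open>1/2\<close> in the generator makes it appear once.\<close>

lemma coord_generator_mult:
  assumes G: "metric_on S G" and u: "smooth_on S u" and v: "smooth_on S v" and z: "z \<in> S"
  shows "coord_generator G h (\<lambda>y. u y * v y) z =
    u z * coord_generator G h v z + v z * coord_generator G h u z + partials u z \<bullet> coord_grad G v z"
proof -
  let ?w = "\<lambda>y. sqrt (det (G y))"
  note diff = smooth_on_differentiable[OF _ z]
  have wV: "smooth_on S (\<lambda>y. ?w y * coord_grad G f y $ i)" if "smooth_on S f" for f i
    by (intro smooth_on_mult smooth_on_sqrt_det[OF G] smooth_on_coord_grad[OF G] that)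
  have "partials (\<lambda>y. ?w y * coord_grad G (\<lambda>y. u y * v y) y $ i) z =
      partials (\<lambda>y. u y * (?w y * coord_grad G v y $ i) + v y * (?w y * coord_grad G u y $ i)) z" for i
  proof (rule partials_cong[OF wV[OF smooth_on_mult[OF u v]] z])
    fix y assume "y \<in> S"
    then have "coord_grad G (\<lambda>y. u y * v y) y = u y *\<^sub>R coord_grad G v y + v y *\<^sub>R coord_grad G u y"
      by (intro coord_grad_mult smooth_on_differentiable[OF u] smooth_on_differentiable[OF v])
    then show "?w y * coord_grad G (\<lambda>y. u y * v y) y $ i =
        u y * (?w y * coord_grad G v y $ i) + v y * (?w y * coord_grad G u y $ i)"
      by (simp add: algebra_simps)
  qed
  also have "partials (\<lambda>y. u y * (?w y * coord_grad G v y $ i) + v y * (?w y * coord_grad G u y $ i)) z =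
      u z *\<^sub>R partials (\<lambda>y. ?w y * coord_grad G v y $ i) z + (?w z * coord_grad G v z $ i) *\<^sub>R partials u z +
      (v z *\<^sub>R partials (\<lambda>y. ?w y * coord_grad G u y $ i) z + (?w z * coord_grad G u z $ i) *\<^sub>R partials v z)" for i
    using diff[OF wV[OF u]] diff[OF wV[OF v]] diff[OF u] diff[OF v]
    by (simp add: partials_add partials_mult differentiable_mult)
  finally have P: "partials (\<lambda>y. ?w y * coord_grad G (\<lambda>y. u y * v y) y $ i) z $ i =
      u z * partials (\<lambda>y. ?w y * coord_grad G v y $ i) z $ i + ?w z * (partials u z $ i * coord_grad G v z $ i) +
      (v z * partials (\<lambda>y. ?w y * coord_grad G u y $ i) z $ i + ?w z * (partials v z $ i * coord_grad G u z $ i))" for i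
    by simp
  have wz: "?w z > 0" using metric_on_det_pos[OF G z] by simp
  have D: "coord_div ?w (coord_grad G (\<lambda>y. u y * v y)) z = u z * coord_div ?w (coord_grad G v) z +
      v z * coord_div ?w (coord_grad G u) z + partials u z \<bullet> coord_grad G v z + partials v z \<bullet> coord_grad G u z"
    unfolding coord_div_def P
    using wz by (simp add: sum.distrib sum_distrib_left[symmetric] inner_vec_def field_simps)
  have "partials v z \<bullet> coord_grad G u z = partials u z \<bullet> coord_grad G v z"
    using metric_on_symmetric[OF G z, of "coord_grad G v z" "coord_grad G u z"]
    by (simp add: metric_on_coord_grad[OF G z] inner_commute)
  then show ?thesis
    unfolding coord_generator_def D
    by (simp add: metric_on_coord_grad[OF G z] partials_mult diff[OF u] diff[OF v] inner_add_right field_simps)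
qed

text \<open>The carre du champ of \<open>u\<close> with itself is \<open>L(u\<^sup>2) - 2 u L u\<close>, and it is a derivation in each
  argument. So \<open>L\<close> of a higher power is determined by \<open>L u\<close> and \<open>L(u\<^sup>2)\<close>.\<close>

lemma coord_generator_power3:
  assumes G: "metric_on S G" and u: "smooth_on S u" and z: "z \<in> S"
  shows "coord_generator G h (\<lambda>y. u y ^ 3) z =
    3 * u z * coord_generator G h (\<lambda>y. (u y)\<^sup>2) z - 3 * (u z)\<^sup>2 * coord_generator G h u z"
proof -
  have uz: "u differentiable (at z)" by (rule smooth_on_differentiable[OF u z])
  have "coord_generator G h (\<lambda>y. u y * (u y * u y)) z =
     u z * coord_generator G h (\<lambda>y. u y * u y) z + (u z * u z) * coord_generator G h u z +
     partials u z \<bullet> coord_grad G (\<lambda>y. u y * u y) z"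
    by (rule coord_generator_mult[OF G u smooth_on_mult[OF u u] z])
  then show ?thesis
    using coord_generator_mult[OF G u u z, of h]
    by (simp add: coord_grad_mult[OF uz uz] power2_eq_square power3_eq_cube scaleR_left_distrib[symmetric]) (simp add: algebra_simps)
qed

lemma coord_generator_power4:
  assumes G: "metric_on S G" and u: "smooth_on S u" and z: "z \<in> S"
  shows "coord_generator G h (\<lambda>y. u y ^ 4) z =
    6 * (u z)\<^sup>2 * coord_generator G h (\<lambda>y. (u y)\<^sup>2) z - 8 * u z ^ 3 * coord_generator G h u z"
proof -
  have uz: "u differentiable (at z)" by (rule smooth_on_differentiable[OF u z])
  have "coord_generator G h (\<lambda>y. (u y * u y) * (u y * u y)) z =
     (u z * u z) * coord_generator G h (\<lambda>y. u y * u y) z + (u z * u z) * coord_generator G h (\<lambda>y. u y * u y) z +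
     partials (\<lambda>y. u y * u y) z \<bullet> coord_grad G (\<lambda>y. u y * u y) z"
    by (rule coord_generator_mult[OF G smooth_on_mult[OF u u] smooth_on_mult[OF u u] z])
  then show ?thesis
    using coord_generator_mult[OF G u u z, of h]
    by (simp add: coord_grad_mult[OF uz uz] partials_mult[OF uz uz] power2_eq_square power3_eq_cube
        power4_eq_xxxx scaleR_left_distrib[symmetric]) (simp add: algebra_simps)
qed

section \<open>Invariance of the generator\<close>

lemma matrix_vector_mult_cancel:
  fixes M :: "real ^ 'n::finite ^ 'n"
  assumes "det M \<noteq> 0" "M *v a = M *v b"
  shows "a = b"
  using assms inj_matrix_vector_mult[of M] by (simp add: invertible_det_nz inj_eq)

lemma inner_transpose_vector:
  fixes M :: "real ^ 'n::finite ^ 'n"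
  shows "a \<bullet> (transpose M *v x) = (M *v a) \<bullet> x"
  by (metis inner_commute dot_lmul_matrix transpose_matrix_vector)

text \<open>The transformation law of the metric makes \<open>det J\<close> nonzero and turns the defining equation
  \<open>G (grad u) = \<partial>u\<close>, together with the chain rule, into \<open>J (grad u) = grad u' \<circ> \<phi>\<close>. The divergence term is
  then covered by \<open>coord_div_invariant\<close>, the inner product of the gradients by the metric law itself.\<close>

lemma coord_generator_invariant:
  fixes \<phi> :: "real ^ 'n::finite \<Rightarrow> real ^ 'n"
  assumes G: "metric_on S G" and G': "metric_on S' G'"
    and \<phi>: "smooth_on S \<phi>" and S': "\<And>y. y \<in> S \<Longrightarrow> \<phi> y \<in> S'"
    and GG': "\<And>y. y \<in> S \<Longrightarrow> G y = transpose (jacobian \<phi> (at y)) ** G' (\<phi> y) ** jacobian \<phi> (at y)"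
    and u': "smooth_on S' u'" and uu': "\<And>y. y \<in> S \<Longrightarrow> u y = u' (\<phi> y)" and u: "smooth_on S u"
    and h': "smooth_on S' h'" and hh': "\<And>y. y \<in> S \<Longrightarrow> h y = h' (\<phi> y)" and h: "smooth_on S h"
    and z: "z \<in> S"
  shows "coord_generator G h u z = coord_generator G' h' u' (\<phi> z)"
proof -
  have det_G: "det (G y) = (det (jacobian \<phi> (at y)))\<^sup>2 * det (G' (\<phi> y))" if "y \<in> S" for y
    by (simp add: GG'[OF that] det_mul power2_eq_square)
  have det_J: "det (jacobian \<phi> (at y)) \<noteq> 0" if "y \<in> S" for y
    using metric_on_det_pos[OF G that] det_G[OF that] by auto
  have grad: "jacobian \<phi> (at y) *v coord_grad G f y = coord_grad G' f' (\<phi> y)"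
    if y: "y \<in> S" and f: "smooth_on S f" and f': "smooth_on S' f'" and ff': "\<And>y. y \<in> S \<Longrightarrow> f y = f' (\<phi> y)" for y f f'
  proof -
    have "transpose (jacobian \<phi> (at y)) *v (G' (\<phi> y) *v (jacobian \<phi> (at y) *v coord_grad G f y)) = partials f y"
      using metric_on_coord_grad[OF G y, of f] by (simp add: GG'[OF y] matrix_vector_mul_assoc matrix_mul_assoc)
    also have "\<dots> = partials (\<lambda>y. f' (\<phi> y)) y"
      by (rule partials_cong[OF f y ff'])
    also have "\<dots> = transpose (jacobian \<phi> (at y)) *v partials f' (\<phi> y)"
      by (intro partials_compose smooth_on_differentiable[OF \<phi> y] smooth_on_differentiable[OF f' S'[OF y]])
    finally have "G' (\<phi> y) *v (jacobian \<phi> (at y) *v coord_grad G f y) = partials f' (\<phi> y)"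
      by (rule matrix_vector_mult_cancel[rotated]) (simp add: det_J[OF y])
    then have "G' (\<phi> y) *v (jacobian \<phi> (at y) *v coord_grad G f y) = G' (\<phi> y) *v coord_grad G' f' (\<phi> y)"
      by (simp add: metric_on_coord_grad[OF G' S'[OF y]])
    then show ?thesis
      by (rule matrix_vector_mult_cancel[rotated]) (use metric_on_det_pos[OF G' S'[OF y]] in simp)
  qed
  have "coord_div (\<lambda>y. sqrt (det (G y))) (coord_grad G u) z =
      coord_div (\<lambda>y. sqrt (det (G' y))) (coord_grad G' u') (\<phi> z)"
  proof (rule coord_div_invariant[OF z \<phi> smooth_on_sqrt_det[OF G] smooth_on_coord_grad[OF G u]
        smooth_on_differentiable[OF smooth_on_sqrt_det[OF G'] S'[OF z]]
        smooth_on_differentiable[OF smooth_on_coord_grad[OF G' u'] S'[OF z]] det_J[OF z]])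
    show "sqrt (det (G z)) \<noteq> 0" using metric_on_det_pos[OF G z] by simp
    show "(sqrt (det (G y)))\<^sup>2 = (det (jacobian \<phi> (at y)))\<^sup>2 * (sqrt (det (G' (\<phi> y))))\<^sup>2" if "y \<in> S" for y
      using metric_on_det_pos[OF G that] metric_on_det_pos[OF G' S'[OF that]] det_G[OF that] by simp
    show "jacobian \<phi> (at y) *v coord_grad G u y = coord_grad G' u' (\<phi> y)" if "y \<in> S" for y
      by (rule grad[OF that u u' uu'])
  qed
  moreover have "coord_grad G h z \<bullet> (G z *v coord_grad G u z) =
      coord_grad G' h' (\<phi> z) \<bullet> (G' (\<phi> z) *v coord_grad G' u' (\<phi> z))"
    unfolding GG'[OF z]
    by (simp only: matrix_vector_mul_assoc[symmetric] inner_transpose_vector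
        grad[OF z u u' uu'] grad[OF z h h' hh'])
  ultimately show ?thesis by (simp add: coord_generator_def)
qed

section \<open>Smooth functions and the generator on the manifold\<close>

lemma smooth_atlas_chart:
  assumes "smooth_atlas A" "c \<in> A"
  shows "open (chart_dom c)" "open (chart_image c)"
    and "continuous_on (chart_dom c) (chart_map c)" "continuous_on (chart_image c) (chart_inv c)"
    and "p \<in> chart_dom c \<Longrightarrow> chart_inv c (chart_map c p) = p"
    and "z \<in> chart_image c \<Longrightarrow> chart_inv c z \<in> chart_dom c"
    and "z \<in> chart_image c \<Longrightarrow> chart_map c (chart_inv c z) = z"
proof -
  have *: "open (chart_dom c)" "open (chart_image c)"
    "homeomorphism (chart_dom c) (chart_image c) (chart_map c) (chart_inv c)"
    using assms by (auto simp: smooth_atlas_def)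
  then show "open (chart_dom c)" "open (chart_image c)"
    "continuous_on (chart_dom c) (chart_map c)" "continuous_on (chart_image c) (chart_inv c)"
    "p \<in> chart_dom c \<Longrightarrow> chart_inv c (chart_map c p) = p"
    "z \<in> chart_image c \<Longrightarrow> chart_inv c z \<in> chart_dom c"
    "z \<in> chart_image c \<Longrightarrow> chart_map c (chart_inv c z) = z"
    by (auto simp: homeomorphism_def)
qed

lemma smooth_atlas_cover:
  assumes "smooth_atlas A"
  obtains c where "c \<in> A" "p \<in> chart_dom c"
proof -
  have "p \<in> (\<Union>c\<in>A. chart_dom c)" using assms by (simp add: smooth_atlas_def)
  then show thesis using that by blast
qed

lemma smooth_fun_chart: "smooth_fun A f \<Longrightarrow> c \<in> A \<Longrightarrow> smooth_on (chart_image c) (f \<circ> chart_inv c)"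
  by (simp add: smooth_fun_def)

lemma smooth_fun_mult:
  assumes "smooth_fun A f" "smooth_fun A h"
  shows "smooth_fun A (\<lambda>p. f p * h p)"
  using assms by (auto simp: smooth_fun_def o_def intro: smooth_on_mult)

lemma smooth_fun_power:
  assumes "smooth_fun A f"
  shows "smooth_fun A (\<lambda>p. f p ^ Suc n)"
  by (induction n) (use assms in \<open>auto intro: smooth_fun_mult\<close>)

text \<open>Continuity is local and the chart domains are open, so a function given in every chart by a
  continuous coordinate expression is continuous.\<close>

lemma continuous_on_of_charts:
  fixes f :: "'m::{t2_space, second_countable_topology} \<Rightarrow> real"
  assumes A: "smooth_atlas A" and c: "\<And>c. c \<in> A \<Longrightarrow> continuous_on (chart_image c) (F c)"
    and eq: "\<And>c p. c \<in> A \<Longrightarrow> p \<in> chart_dom c \<Longrightarrow> f p = F c (chart_map c p)"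
  shows "continuous_on UNIV f"
proof -
  have "continuous_on (\<Union>c\<in>A. chart_dom c) f"
  proof (rule continuous_on_open_UN)
    fix c assume cA: "c \<in> A"
    show "open (chart_dom c)" by (rule smooth_atlas_chart(1)[OF A cA])
    have "continuous_on (chart_dom c) (\<lambda>p. F c (chart_map c p))"
      by (rule continuous_on_compose2[OF c[OF cA] smooth_atlas_chart(3)[OF A cA]]) auto
    then show "continuous_on (chart_dom c) f"
      using eq[OF cA] by (auto intro: continuous_on_eq)
  qed
  then show ?thesis using A by (simp add: smooth_atlas_def)
qed

lemma smooth_fun_continuous_on:
  assumes A: "smooth_atlas A" and f: "smooth_fun A f"
  shows "continuous_on UNIV f"
  by (rule continuous_on_of_charts[OF A smooth_on_continuous_on[OF smooth_fun_chart[OF f]]])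
    (simp_all add: smooth_atlas_chart(5)[OF A])

lemma metric_on_chart_image:
  assumes A: "smooth_atlas A" and g: "riemannian_metric A g" and c: "c \<in> A"
  shows "metric_on (chart_image c) (\<lambda>z. g c (chart_inv c z))"
  using smooth_atlas_chart[OF A c] g c by (auto simp: metric_on_def riemannian_metric_def)

text \<open>The manifold operators of a single chart are the coordinate operators. The derivatives only
  see a neighbourhood of the point, and on the image of the chart the two sides agree as functions.\<close>

lemma chart_generator_eq:
  assumes A: "smooth_atlas A" and g: "riemannian_metric A g" and f: "smooth_fun A f"
    and c: "c \<in> A" and p: "p \<in> chart_dom c"
  shows "(laplace_beltrami g c f p - metric_inner g c p (gradient g c H p) (gradient g c f p)) / 2 =
    coord_generator (\<lambda>z. g c (chart_inv c z)) (H \<circ> chart_inv c) (f \<circ> chart_inv c) (chart_map c p)"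
proof -
  let ?G = "\<lambda>z. g c (chart_inv c z)"
  note G = metric_on_chart_image[OF A g c]
  have grad: "gradient g c h q = coord_grad ?G (h \<circ> chart_inv c) (chart_map c q)" if "q \<in> chart_dom c" for q h
    using that by (simp add: gradient_def coord_grad_def coord_deriv_def partials_def smooth_atlas_chart(5)[OF A c])
  have "partials (\<lambda>z. sqrt (det (?G z)) * coord_grad ?G (f \<circ> chart_inv c) z $ i) (chart_map c p) =
      partials ((\<lambda>q. volume_density g c q * gradient g c f q $ i) \<circ> chart_inv c) (chart_map c p)" for i
  proof (rule partials_cong)
    show "smooth_on (chart_image c) (\<lambda>z. sqrt (det (?G z)) * coord_grad ?G (f \<circ> chart_inv c) z $ i)"
      by (intro smooth_on_mult smooth_on_sqrt_det[OF G] smooth_on_coord_grad[OF G] smooth_fun_chart[OF f c])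
    show "chart_map c p \<in> chart_image c" using p by simp
    show "sqrt (det (?G z)) * coord_grad ?G (f \<circ> chart_inv c) z $ i =
        ((\<lambda>q. volume_density g c q * gradient g c f q $ i) \<circ> chart_inv c) z" if "z \<in> chart_image c" for z
      using that by (simp add: grad smooth_atlas_chart[OF A c] volume_density_def)
  qed
  then have "laplace_beltrami g c f p =
      coord_div (\<lambda>z. sqrt (det (?G z))) (coord_grad ?G (f \<circ> chart_inv c)) (chart_map c p)"
    using p by (simp add: laplace_beltrami_def divergence_def coord_div_def coord_deriv_def partials_def
        volume_density_def smooth_atlas_chart(5)[OF A c] vec_eq_iff)
  then show ?thesis
    using p by (simp add: coord_generator_def metric_inner_def grad smooth_atlas_chart(5)[OF A c])
qed

text \<open>The generator selects some chart around \<open>p\<close>; invariance under the transition map allows it to be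
  computed in any other one.\<close>

lemma generator_eq_coord_generator:
  assumes A: "smooth_atlas A" and g: "riemannian_metric A g"
    and H: "smooth_fun A H" and f: "smooth_fun A f"
    and c: "c \<in> A" and p: "p \<in> chart_dom c"
  shows "generator A g H f p =
    coord_generator (\<lambda>z. g c (chart_inv c z)) (H \<circ> chart_inv c) (f \<circ> chart_inv c) (chart_map c p)"
proof -
  define c' where "c' = (SOME c. c \<in> A \<and> p \<in> chart_dom c)"
  have c': "c' \<in> A" "p \<in> chart_dom c'"
    unfolding c'_def using someI[of "\<lambda>c. c \<in> A \<and> p \<in> chart_dom c" c] c p by auto
  define S where "S = chart_map c ` (chart_dom c \<inter> chart_dom c')"
  define \<phi> where "\<phi> = chart_map c' \<circ> chart_inv c"
  have \<phi>: "smooth_on S \<phi>"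
    using A c c'(1) by (simp add: smooth_atlas_def S_def \<phi>_def)
  have sub: "S \<subseteq> chart_image c" by (auto simp: S_def)
  have inv: "chart_inv c y \<in> chart_dom c" "chart_inv c y \<in> chart_dom c'" "chart_map c (chart_inv c y) = y"
    if "y \<in> S" for y
    using that smooth_atlas_chart(5)[OF A c] by (auto simp: S_def)
  have G: "metric_on S (\<lambda>z. g c (chart_inv c z))"
    using metric_on_chart_image[OF A g c] smooth_on_imp_open[OF \<phi>] sub
    by (auto simp: metric_on_def intro: smooth_on_subset)
  have smooth: "smooth_on S (h \<circ> chart_inv c)" if "smooth_fun A h" for h
    by (rule smooth_on_subset[OF smooth_fun_chart[OF that c] smooth_on_imp_open[OF \<phi>] sub])
  have "coord_generator (\<lambda>z. g c (chart_inv c z)) (H \<circ> chart_inv c) (f \<circ> chart_inv c) (chart_map c p) =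
      coord_generator (\<lambda>z. g c' (chart_inv c' z)) (H \<circ> chart_inv c') (f \<circ> chart_inv c') (\<phi> (chart_map c p))"
  proof (rule coord_generator_invariant[OF G metric_on_chart_image[OF A g c'(1)] \<phi> _ _
        smooth_fun_chart[OF f c'(1)] _ smooth[OF f] smooth_fun_chart[OF H c'(1)] _ smooth[OF H]])
    show "\<phi> y \<in> chart_image c'" if "y \<in> S" for y
      using inv[OF that] by (simp add: \<phi>_def)
    show "g c (chart_inv c y) =
        transpose (jacobian \<phi> (at y)) ** g c' (chart_inv c' (\<phi> y)) ** jacobian \<phi> (at y)" if "y \<in> S" for y
    proof -
      have "\<forall>q\<in>chart_dom c \<inter> chart_dom c'.
          let J = matrix (frechet_derivative (chart_map c' \<circ> chart_inv c) (at (chart_map c q)))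
          in g c q = transpose J ** g c' q ** J"
        using g c c'(1) unfolding riemannian_metric_def by blast
      then show ?thesis
        using inv[OF that] smooth_atlas_chart(5)[OF A c'(1)]
        by (auto simp: Let_def \<phi>_def jacobian_def)
    qed
    show "(f \<circ> chart_inv c) y = (f \<circ> chart_inv c') (\<phi> y)" "(H \<circ> chart_inv c) y = (H \<circ> chart_inv c') (\<phi> y)"
      if "y \<in> S" for y
      using inv[OF that] smooth_atlas_chart(5)[OF A c'(1)] by (simp_all add: \<phi>_def)
    show "chart_map c p \<in> S" using p c'(2) by (simp add: S_def)
  qed
  also have "\<phi> (chart_map c p) = chart_map c' p"
    using smooth_atlas_chart(5)[OF A c p] by (simp add: \<phi>_def)
  finally show ?thesis
    using chart_generator_eq[OF A g f c', of H] by (simp add: generator_def c'_def[symmetric] o_def)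
qed

lemma generator_continuous_on:
  assumes A: "smooth_atlas A" and g: "riemannian_metric A g"
    and H: "smooth_fun A H" and f: "smooth_fun A f"
  shows "continuous_on UNIV (generator A g H f)"
  by (rule continuous_on_of_charts[OF A smooth_on_continuous_on[OF
        smooth_on_coord_generator[OF metric_on_chart_image[OF A g] smooth_fun_chart[OF H] smooth_fun_chart[OF f]]]])
    (simp_all add: generator_eq_coord_generator[OF A g H f])

lemma generator_power:
  assumes A: "smooth_atlas A" and g: "riemannian_metric A g"
    and H: "smooth_fun A H" and f: "smooth_fun A f"
  shows "generator A g H (\<lambda>p. f p ^ 3) p =
      3 * f p * generator A g H (\<lambda>p. (f p)\<^sup>2) p - 3 * (f p)\<^sup>2 * generator A g H f p"
    and "generator A g H (\<lambda>p. f p ^ 4) p =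
      6 * (f p)\<^sup>2 * generator A g H (\<lambda>p. (f p)\<^sup>2) p - 8 * f p ^ 3 * generator A g H f p"
proof -
  obtain c where c: "c \<in> A" "p \<in> chart_dom c" using smooth_atlas_cover[OF A] .
  have "chart_map c p \<in> chart_image c" using c by simp
  note pow = coord_generator_power3[OF metric_on_chart_image[OF A g c(1)] smooth_fun_chart[OF f c(1)] this]
    coord_generator_power4[OF metric_on_chart_image[OF A g c(1)] smooth_fun_chart[OF f c(1)] this]
  have f2: "smooth_fun A (\<lambda>p. (f p)\<^sup>2)" and f3: "smooth_fun A (\<lambda>p. f p ^ 3)" and f4: "smooth_fun A (\<lambda>p. f p ^ 4)"
    using smooth_fun_power[OF f, of 1] smooth_fun_power[OF f, of 2] smooth_fun_power[OF f, of 3]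
    by (simp_all add: numeral_eq_Suc)
  note eq = generator_eq_coord_generator[OF A g H _ c]
  show "generator A g H (\<lambda>p. f p ^ 3) p =
      3 * f p * generator A g H (\<lambda>p. (f p)\<^sup>2) p - 3 * (f p)\<^sup>2 * generator A g H f p"
    unfolding eq[OF f] eq[OF f2] eq[OF f3]
    using pow(1)[of "H \<circ> chart_inv c"] smooth_atlas_chart(5)[OF A c] by (simp add: o_def)
  show "generator A g H (\<lambda>p. f p ^ 4) p =
      6 * (f p)\<^sup>2 * generator A g H (\<lambda>p. (f p)\<^sup>2) p - 8 * f p ^ 3 * generator A g H f p"
    unfolding eq[OF f] eq[OF f2] eq[OF f4]
    using pow(2)[of "H \<circ> chart_inv c"] smooth_atlas_chart(5)[OF A c] by (simp add: o_def)
qed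

section \<open>Martingales and the initial value\<close>

text \<open>The random variables generating the filtration are measurable, so it consists of events.\<close>

lemma natural_filtration_subalgebra:
  assumes X: "\<And>s. 0 \<le> s \<Longrightarrow> X s \<in> measurable P borel"
  shows "subalgebra P (natural_filtration P X t)"
proof -
  have "{X s -` B \<inter> space P | s B. 0 \<le> s \<and> s \<le> t \<and> B \<in> sets borel} \<subseteq> sets P"
    using X by (auto intro: measurable_sets)
  then show ?thesis
    unfolding subalgebra_def natural_filtration_def
    by (auto simp: space_measure_of_conv sets_measure_of_conv intro: sets.sigma_sets_subset[THEN subsetD])
qed

lemma measurable_natural_filtration:
  assumes "0 \<le> s" "s \<le> t"
  shows "X s \<in> measurable (natural_filtration P X t) borel"
proof (rule measurableI)
  fix B :: "'b set" assume "B \<in> sets borel"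
  then have "X s -` B \<inter> space P \<in> {X s -` B \<inter> space P | s B. 0 \<le> s \<and> s \<le> t \<and> B \<in> sets borel}"
    using assms by blast
  then show "X s -` B \<inter> space (natural_filtration P X t) \<in> sets (natural_filtration P X t)"
    unfolding natural_filtration_def
    by (simp add: space_measure_of_conv sets_measure_of_conv) (blast intro: sigma_sets.Basic)
qed simp

text \<open>Conditioning on time \<open>0\<close>: a function of the initial value is measurable for the initial
  sigma-algebra and can be pulled out of the conditional expectation, which is \<open>N\<^sub>0 = 0\<close>.\<close>

lemma martingale_times_initial_value:
  fixes X :: "real \<Rightarrow> 'w \<Rightarrow> 'm::topological_space" and h :: "'m \<Rightarrow> real"
  assumes P: "prob_space P" and X: "\<And>s. 0 \<le> s \<Longrightarrow> X s \<in> measurable P borel"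
    and N: "is_martingale P (natural_filtration P X) N" and N0: "\<And>\<omega>. \<omega> \<in> space P \<Longrightarrow> N 0 \<omega> = 0"
    and h: "h \<in> borel_measurable borel" and h_bound: "\<And>p. \<bar>h p\<bar> \<le> C" and t: "0 \<le> t"
  shows "integrable P (\<lambda>\<omega>. h (X 0 \<omega>) * N t \<omega>)" and "(\<integral>\<omega>. h (X 0 \<omega>) * N t \<omega> \<partial>P) = 0"
proof -
  interpret prob_space P by fact
  let ?F = "natural_filtration P X 0"
  interpret finite_measure_subalgebra P ?F
    by unfold_locales (rule natural_filtration_subalgebra[OF X])
  have N_int: "integrable P (N t)" and ce: "AE \<omega> in P. real_cond_exp P ?F (N t) \<omega> = N 0 \<omega>"
    using N t unfolding is_martingale_def by auto
  have hX: "(\<lambda>\<omega>. h (X 0 \<omega>)) \<in> borel_measurable ?F"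
    by (rule measurable_compose[OF measurable_natural_filtration h]) auto
  then have hXP: "(\<lambda>\<omega>. h (X 0 \<omega>)) \<in> borel_measurable P"
    by (rule measurable_from_subalg[OF subalg])
  show int: "integrable P (\<lambda>\<omega>. h (X 0 \<omega>) * N t \<omega>)"
  proof (rule Bochner_Integration.integrable_bound)
    show "integrable P (\<lambda>\<omega>. C * N t \<omega>)" using N_int by simp
    show "(\<lambda>\<omega>. h (X 0 \<omega>) * N t \<omega>) \<in> borel_measurable P" using hXP N_int by auto
    have "0 \<le> C" using h_bound[of undefined] by linarith
    then show "AE \<omega> in P. norm (h (X 0 \<omega>) * N t \<omega>) \<le> norm (C * N t \<omega>)"
      using h_bound by (auto simp: abs_mult intro!: mult_right_mono)
  qed
  have "(\<integral>\<omega>. h (X 0 \<omega>) * N t \<omega> \<partial>P) = (\<integral>\<omega>. h (X 0 \<omega>) * real_cond_exp P ?F (N t) \<omega> \<partial>P)"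
    using N_int by (intro real_cond_exp_intg(2)[OF int hX, symmetric]) auto
  also have "\<dots> = (\<integral>\<omega>. 0 \<partial>P)"
  proof (rule integral_cong_AE)
    show "(\<lambda>\<omega>. h (X 0 \<omega>) * real_cond_exp P ?F (N t) \<omega>) \<in> borel_measurable P"
      using hXP by measurable
    show "AE \<omega> in P. h (X 0 \<omega>) * real_cond_exp P ?F (N t) \<omega> = 0"
      using ce AE_space by eventually_elim (simp add: N0)
  qed simp
  finally show "(\<integral>\<omega>. h (X 0 \<omega>) * N t \<omega> \<partial>P) = 0" by simp
qed

section \<open>Fourth moments of increments at small times\<close>

lemma set_integral_abs_le:
  fixes \<phi> :: "real \<Rightarrow> real"
  assumes \<phi>: "continuous_on {0..t} \<phi>" and C: "\<And>s. 0 \<le> s \<Longrightarrow> s \<le> t \<Longrightarrow> \<bar>\<phi> s\<bar> \<le> C" and t: "0 \<le> t"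
  shows "\<bar>\<integral>s\<in>{0..t}. \<phi> s \<partial>lborel\<bar> \<le> C * t"
proof -
  have "\<bar>\<integral>s\<in>{0..t}. \<phi> s \<partial>lborel\<bar> \<le> (\<integral>s\<in>{0..t}. \<bar>\<phi> s\<bar> \<partial>lborel)"
    using set_integral_norm_bound[OF borel_integrable_atLeastAtMost'[OF \<phi>]] by simp
  also have "\<dots> \<le> (\<integral>s\<in>{0..t}. C \<partial>lborel)"
    by (intro set_integral_mono borel_integrable_atLeastAtMost' continuous_intros \<phi>) (auto intro: C)
  also have "\<dots> = C * t" using t by (simp add: set_lebesgue_integral_def)
  finally show ?thesis .
qed

text \<open>A function that is small on \<open>[0, t]\<close> has a small average there.\<close>

lemma time_average_tendsto:
  fixes \<phi> :: "real \<Rightarrow> real"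
  assumes \<phi>: "continuous_on {0..} \<phi>" and \<phi>0: "\<phi> 0 = 0"
  shows "((\<lambda>t. 1 / t * (\<integral>s\<in>{0..t}. \<phi> s \<partial>lborel)) \<longlongrightarrow> 0) (at_right 0)"
proof (rule tendstoI)
  fix e :: real assume e: "e > 0"
  obtain d where d: "d > 0" "\<And>s. 0 \<le> s \<Longrightarrow> s < d \<Longrightarrow> \<bar>\<phi> s\<bar> < e / 2"
    using \<phi> e \<phi>0 unfolding continuous_on_iff
    by (metis abs_of_nonneg atLeast_iff diff_zero dist_real_def half_gt_zero order_refl)
  have "dist (1 / t * (\<integral>s\<in>{0..t}. \<phi> s \<partial>lborel)) 0 < e" if t: "0 < t" "t < d" for t
  proof -
    have "\<bar>\<integral>s\<in>{0..t}. \<phi> s \<partial>lborel\<bar> \<le> e / 2 * t"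
      using t d(2) by (intro set_integral_abs_le continuous_on_subset[OF \<phi>]) (auto intro: less_imp_le)
    also have "\<dots> < e * t" using e t by simp
    finally show ?thesis using t by (simp add: dist_real_def abs_mult field_simps)
  qed
  then show "\<forall>\<^sub>F t in at_right 0. dist (1 / t * (\<integral>s\<in>{0..t}. \<phi> s \<partial>lborel)) 0 < e"
    using d(1) unfolding eventually_at_right_field by blast
qed

lemma integrable_increment_power:
  fixes f :: "'m::topological_space \<Rightarrow> real"
  assumes P: "prob_space P" and compact: "compact (UNIV :: 'm set)" and f: "continuous_on UNIV f"
    and Y: "Y \<in> measurable P borel" and Z: "Z \<in> measurable P borel"
  shows "integrable P (\<lambda>\<omega>. (f (Y \<omega>) - f (Z \<omega>)) ^ n)"
proof -
  interpret prob_space P by (rule P)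
  obtain B where B: "\<And>p. \<bar>f p\<bar> \<le> B"
    using compact_imp_bounded[OF compact_continuous_image[OF f compact]] by (auto simp: bounded_iff)
  have "\<bar>f (Y \<omega>) - f (Z \<omega>)\<bar> \<le> 2 * B" for \<omega>
    using B[of "Y \<omega>"] B[of "Z \<omega>"] by linarith
  then have "\<bar>f (Y \<omega>) - f (Z \<omega>)\<bar> ^ n \<le> (2 * B) ^ n" for \<omega>
    by (intro power_mono) auto
  then have "norm ((f (Y \<omega>) - f (Z \<omega>)) ^ n) \<le> (2 * B) ^ n" for \<omega>
    by (simp only: real_norm_def power_abs)
  moreover have "(\<lambda>\<omega>. (f (Y \<omega>) - f (Z \<omega>)) ^ n) \<in> borel_measurable P"
    using Y Z borel_measurable_continuous_onI[OF f] by measurable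
  ultimately show ?thesis by (intro integrable_const_bound[of _ "(2 * B) ^ n"] AE_I2)
qed

text \<open>Stated for any operator \<open>L\<close> that is second order in the sense of the identities for \<open>L(f\<^sup>3)\<close> and
  \<open>L(f\<^sup>4)\<close>. They give
  \<open>L(f\<^sup>4) - 4 a L(f\<^sup>3) + 6 a\<^sup>2 L(f\<^sup>2) - 4 a\<^sup>3 L f = (f - a)\<^sup>2 (6 L(f\<^sup>2) - 4 (2 f + a) L f)\<close> for constant \<open>a\<close>,
  so the expected fourth power is the expected time integral of a bounded quantity that vanishes as
  the path returns to its starting point.\<close>

lemma fourth_moment_small_time:
  fixes X :: "real \<Rightarrow> 'w \<Rightarrow> 'm::topological_space" and f :: "'m \<Rightarrow> real"
  assumes P: "prob_space P" and compact: "compact (UNIV :: 'm set)"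
    and X: "\<And>s. 0 \<le> s \<Longrightarrow> X s \<in> measurable P borel"
    and paths: "\<And>\<omega>. \<omega> \<in> space P \<Longrightarrow> continuous_on {0..} (\<lambda>s. X s \<omega>)"
    and f: "continuous_on UNIV f"
    and L: "\<And>j. j \<in> {1..4} \<Longrightarrow> continuous_on UNIV (L (\<lambda>p. f p ^ j))"
    and mart: "\<And>j. j \<in> {1..4} \<Longrightarrow> is_martingale P (natural_filtration P X)
      (\<lambda>t \<omega>. f (X t \<omega>) ^ j - f (X 0 \<omega>) ^ j - (\<integral>s\<in>{0..t}. L (\<lambda>p. f p ^ j) (X s \<omega>) \<partial>lborel))"
    and L3: "\<And>p. L (\<lambda>p. f p ^ 3) p =
      3 * f p * L (\<lambda>p. f p ^ 2) p - 3 * (f p)\<^sup>2 * L (\<lambda>p. f p ^ 1) p"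
    and L4: "\<And>p. L (\<lambda>p. f p ^ 4) p =
      6 * (f p)\<^sup>2 * L (\<lambda>p. f p ^ 2) p - 8 * f p ^ 3 * L (\<lambda>p. f p ^ 1) p"
  shows "((\<lambda>t. 1 / t * (\<integral>\<omega>. (f (X t \<omega>) - f (X 0 \<omega>)) ^ 4 \<partial>P)) \<longlongrightarrow> 0) (at_right 0)"
proof -
  interpret prob_space P by fact
  define l where "l j = L (\<lambda>p. f p ^ j)" for j :: nat
  define N where "N j t \<omega> = f (X t \<omega>) ^ j - f (X 0 \<omega>) ^ j - (\<integral>s\<in>{0..t}. l j (X s \<omega>) \<partial>lborel)" for j t \<omega>
  \<comment> \<open>\<open>L\<close> applied to \<open>(f - f x)\<^sup>4\<close>, evaluated at \<open>y\<close>.\<close>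
  define \<Phi> where "\<Phi> x y = (f y - f x)\<^sup>2 * (6 * l 2 y - 4 * (2 * f y + f x) * l 1 y)" for x y
  define I where "I t \<omega> = (\<integral>s\<in>{0..t}. \<Phi> (X 0 \<omega>) (X s \<omega>) \<partial>lborel)" for t \<omega>
  have l: "continuous_on UNIV (l j)" if "j \<in> {1..4}" for j
    unfolding l_def by (rule L[OF that])
  have bounded: "\<exists>B. \<forall>p. \<bar>h p\<bar> \<le> B" if h: "continuous_on UNIV h" for h :: "'m \<Rightarrow> real"
    using compact_imp_bounded[OF compact_continuous_image[OF h compact]]
    by (auto simp: bounded_iff)
  have path: "continuous_on {0..} (\<lambda>s. h (X s \<omega>))" if "\<omega> \<in> space P" "continuous_on UNIV h" for h :: "'m \<Rightarrow> real" and \<omega>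
    by (rule continuous_on_compose2[OF that(2) paths[OF that(1)]]) simp
  note f_borel [measurable] = borel_measurable_continuous_onI[OF f]
  have fX [measurable]: "(\<lambda>\<omega>. f (X t \<omega>)) \<in> borel_measurable P" if "0 \<le> t" for t
    using measurable_compose[OF X[OF that] f_borel] .
  \<comment> \<open>The binomial expansion, with \<open>f (X 0 \<omega>)\<close> playing the part of a constant: the increments of the
    powers are traded for the martingales \<open>N j\<close>.\<close>
  have decomp: "(f (X t \<omega>) - f (X 0 \<omega>)) ^ 4 - I t \<omega> = N 4 t \<omega> + - 4 * f (X 0 \<omega>) * N 3 t \<omega>
      + 6 * (f (X 0 \<omega>))\<^sup>2 * N 2 t \<omega> + - 4 * f (X 0 \<omega>) ^ 3 * N 1 t \<omega>"
    if \<omega>: "\<omega> \<in> space P" and t: "0 \<le> t" for t \<omega>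
  proof -
    define a where "a = f (X 0 \<omega>)"
    have int: "set_integrable lborel {0..t} (\<lambda>s. l j (X s \<omega>))" if "j \<in> {1..4}" for j
      by (rule borel_integrable_atLeastAtMost'[OF continuous_on_subset[OF path[OF \<omega> l[OF that]]]]) simp
    have l34: "l 3 p = 3 * f p * l 2 p - 3 * (f p)\<^sup>2 * l 1 p"
      "l 4 p = 6 * (f p)\<^sup>2 * l 2 p - 8 * f p ^ 3 * l 1 p" for p
      unfolding l_def by (rule L3, rule L4)
    have "\<Phi> (X 0 \<omega>) p = l 4 p + - 4 * a * l 3 p + 6 * a\<^sup>2 * l 2 p + - 4 * a ^ 3 * l 1 p" for p
      unfolding \<Phi>_def l34 a_def[symmetric]
      by (simp add: algebra_simps power2_eq_square power3_eq_cube)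
    then have "I t \<omega> = (\<integral>s\<in>{0..t}. l 4 (X s \<omega>) \<partial>lborel) + - 4 * a * (\<integral>s\<in>{0..t}. l 3 (X s \<omega>) \<partial>lborel)
        + 6 * a\<^sup>2 * (\<integral>s\<in>{0..t}. l 2 (X s \<omega>) \<partial>lborel) + - 4 * a ^ 3 * (\<integral>s\<in>{0..t}. l 1 (X s \<omega>) \<partial>lborel)"
      unfolding I_def
      by (simp only: set_integral_add(2) set_integral_add(1) set_integrable_mult_right set_integral_mult_right int)
        (simp add: int set_integral_add set_integrable_mult_right)
    then show ?thesis
      unfolding N_def a_def
      by (simp add: algebra_simps power2_eq_square power3_eq_cube power4_eq_xxxx)
  qed
  have expect: "integrable P (I t)" "(\<integral>\<omega>. (f (X t \<omega>) - f (X 0 \<omega>)) ^ 4 \<partial>P) = (\<integral>\<omega>. I t \<omega> \<partial>P)" if t: "0 \<le> t" for t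
  proof -
    have N0: "N j 0 \<omega> = 0" for j \<omega>
      unfolding N_def set_lebesgue_integral_def
      using AE_lborel_singleton[of "0 :: real"]
      by (subst integral_eq_zero_AE) (auto elim: eventually_mono)
    have N_mart: "is_martingale P (natural_filtration P X) (N j)" if "j \<in> {1..4}" for j
      using mart[OF that] by (simp add: N_def[abs_def] l_def)
    have weighted: "integrable P (\<lambda>\<omega>. h (X 0 \<omega>) * N j t \<omega>)" "(\<integral>\<omega>. h (X 0 \<omega>) * N j t \<omega> \<partial>P) = 0"
      if j: "j \<in> {1..4}" and h: "continuous_on UNIV h" for h j
    proof -
      obtain B where "\<And>p. \<bar>h p\<bar> \<le> B" using bounded[OF h] by blast
      from martingale_times_initial_value[OF P X N_mart[OF j] N0 borel_measurable_continuous_onI[OF h] this t]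
      show "integrable P (\<lambda>\<omega>. h (X 0 \<omega>) * N j t \<omega>)" "(\<integral>\<omega>. h (X 0 \<omega>) * N j t \<omega> \<partial>P) = 0" by auto
    qed
    note terms = weighted[of 4 "\<lambda>_. 1"] weighted[of 3 "\<lambda>p. - 4 * f p"] weighted[of 2 "\<lambda>p. 6 * (f p)\<^sup>2"] weighted[of 1 "\<lambda>p. - 4 * f p ^ 3"]
    have c: "continuous_on UNIV (\<lambda>p. - 4 * f p)" "continuous_on UNIV (\<lambda>p. 6 * (f p)\<^sup>2)" "continuous_on UNIV (\<lambda>p. - 4 * f p ^ 3)"
      by (intro continuous_on_mult continuous_on_const continuous_on_power f)+
    let ?D = "\<lambda>\<omega>. (f (X t \<omega>) - f (X 0 \<omega>)) ^ 4 - I t \<omega>"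
    have D: "integrable P ?D" "(\<integral>\<omega>. ?D \<omega> \<partial>P) = 0"
    proof -
      let ?S = "\<lambda>\<omega>. N 4 t \<omega> + - 4 * f (X 0 \<omega>) * N 3 t \<omega>
        + 6 * (f (X 0 \<omega>))\<^sup>2 * N 2 t \<omega> + - 4 * f (X 0 \<omega>) ^ 3 * N 1 t \<omega>"
      have "integrable P ?S" "integral\<^sup>L P ?S = 0"
        using terms c by simp_all
      then show "integrable P ?D" "(\<integral>\<omega>. ?D \<omega> \<partial>P) = 0"
        using decomp[OF _ t] by (simp_all cong: Bochner_Integration.integrable_cong Bochner_Integration.integral_cong)
    qed
    have q: "integrable P (\<lambda>\<omega>. (f (X t \<omega>) - f (X 0 \<omega>)) ^ 4)"
      by (rule integrable_increment_power[OF P compact f X[OF t] X]) simp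
    have "integrable P (\<lambda>\<omega>. (f (X t \<omega>) - f (X 0 \<omega>)) ^ 4 - ?D \<omega>)"
      by (rule Bochner_Integration.integrable_diff[OF q D(1)])
    then show I: "integrable P (I t)" by simp
    show "(\<integral>\<omega>. (f (X t \<omega>) - f (X 0 \<omega>)) ^ 4 \<partial>P) = (\<integral>\<omega>. I t \<omega> \<partial>P)"
      using D(2) Bochner_Integration.integral_diff[OF q I] by simp
  qed
  obtain C where C: "\<And>x y. \<bar>\<Phi> x y\<bar> \<le> C"
  proof -
    obtain B B1 B2 where B: "\<And>p. \<bar>f p\<bar> \<le> B" "\<And>p. \<bar>l 1 p\<bar> \<le> B1" "\<And>p. \<bar>l 2 p\<bar> \<le> B2"
      using bounded[OF f] bounded[OF l[of 1]] bounded[OF l[of 2]] by auto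
    have "\<bar>\<Phi> x y\<bar> \<le> (2 * B)\<^sup>2 * (6 * B2 + 4 * (3 * B) * B1)" for x y
    proof -
      have "\<bar>4 * (2 * f y + f x) * l 1 y\<bar> \<le> 4 * (3 * B) * B1"
        unfolding abs_mult using B(1)[of x] B(1)[of y] B(2)[of y]
        by (intro mult_mono) auto
      then have "\<bar>6 * l 2 y - 4 * (2 * f y + f x) * l 1 y\<bar> \<le> 6 * B2 + 4 * (3 * B) * B1"
        using B(3)[of y] by linarith
      moreover have "\<bar>(f y - f x)\<^sup>2\<bar> \<le> (2 * B)\<^sup>2"
        unfolding power_abs using B(1)[of x] B(1)[of y] by (intro power_mono) auto
      ultimately show ?thesis
        unfolding \<Phi>_def abs_mult[of "(f y - f x)\<^sup>2"] by (intro mult_mono) auto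
    qed
    then show thesis by (rule that)
  qed
  have \<Phi>_path: "continuous_on {0..} (\<lambda>s. \<Phi> (X 0 \<omega>) (X s \<omega>))" if "\<omega> \<in> space P" for \<omega>
    unfolding \<Phi>_def
    by (intro continuous_on_mult continuous_on_diff continuous_on_add continuous_on_power continuous_on_const
        path[OF that f] path[OF that l]) auto
  have "((\<lambda>t. \<integral>\<omega>. 1 / t * I t \<omega> \<partial>P) \<longlongrightarrow> 0) (at_right 0)"
  proof (rule tendsto_at_right_sequentially[of 0 1])
    fix S :: "nat \<Rightarrow> real"
    assume S: "\<And>n. 0 < S n" "S \<longlonglongrightarrow> 0"
    have "(\<lambda>n. \<integral>\<omega>. 1 / S n * I (S n) \<omega> \<partial>P) \<longlonglongrightarrow> (\<integral>\<omega>. 0 \<partial>P)"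
    proof (rule integral_dominated_convergence[where w = "\<lambda>_. C"])
      show "(\<lambda>\<omega>. 1 / S n * I (S n) \<omega>) \<in> borel_measurable P" for n
        using borel_measurable_integrable[OF expect(1)[of "S n"]] S(1)[of n] by simp
      have S0: "filterlim S (at_right 0) sequentially"
        using S by (auto simp: filterlim_at less_imp_neq[THEN not_sym])
      show "AE \<omega> in P. (\<lambda>n. 1 / S n * I (S n) \<omega>) \<longlonglongrightarrow> 0"
        unfolding I_def
        by (intro AE_I2 filterlim_compose[OF time_average_tendsto[OF \<Phi>_path] S0]) (auto simp: \<Phi>_def)
      show "AE \<omega> in P. norm (1 / S n * I (S n) \<omega>) \<le> C" for n
      proof (rule AE_I2)
        fix \<omega> assume "\<omega> \<in> space P"
        then have "\<bar>I (S n) \<omega>\<bar> \<le> C * S n"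
          unfolding I_def
          using S(1)[of n] C by (intro set_integral_abs_le continuous_on_subset[OF \<Phi>_path]) auto
        then show "norm (1 / S n * I (S n) \<omega>) \<le> C"
          using S(1)[of n] by (simp add: abs_mult field_simps)
      qed
    qed simp_all
    then show "(\<lambda>n. \<integral>\<omega>. 1 / S n * I (S n) \<omega> \<partial>P) \<longlonglongrightarrow> 0" by simp
  qed simp
  then show ?thesis
    by (rule Lim_transform_eventually) (auto simp: expect(2) eventually_at_right_field intro!: exI[of _ 1])
qed

section \<open>Small-time tails of the increments\<close>

text \<open>Chebyshev's trick \<open>|v|\<^sup>2 \<rho> \<le> |v|\<^sup>4\<close> on the tail event, followed by the Cauchy--Schwarz inequality for
  \<open>|v|\<^sup>4 = (\<Sum>\<^sub>i v\<^sub>i\<^sup>2)\<^sup>2\<close>.\<close>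

lemma norm_square_tail_le:
  fixes v :: "real ^ 'k::finite"
  assumes "\<rho> > 0"
  shows "(norm v)\<^sup>2 * indicator {v. (norm v)\<^sup>2 > \<rho>} v \<le> real CARD('k) / \<rho> * (\<Sum>i\<in>UNIV. (v $ i) ^ 4)"
proof (cases "(norm v)\<^sup>2 > \<rho>")
  case True
  have sq: "(norm v)\<^sup>2 = (\<Sum>i\<in>UNIV. (v $ i)\<^sup>2)"
    by (simp add: norm_vec_def L2_set_def sum_nonneg)
  have "(norm v)\<^sup>2 * \<rho> \<le> (norm v)\<^sup>2 * (norm v)\<^sup>2"
    using True by (intro mult_left_mono) auto
  also have "\<dots> = (\<Sum>i\<in>UNIV. (v $ i)\<^sup>2)\<^sup>2"
    unfolding sq by (simp add: power2_eq_square)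
  also have "\<dots> \<le> (\<Sum>i\<in>UNIV. ((v $ i)\<^sup>2)\<^sup>2) * real CARD('k)"
    by (rule sum_squared_le_sum_of_squares)
  also have "\<dots> = real CARD('k) * (\<Sum>i\<in>UNIV. (v $ i) ^ 4)"
    by (simp add: mult.commute)
  finally show ?thesis using True assms by (simp add: field_simps)
next
  case False
  then show ?thesis using assms by (simp add: sum_nonneg)
qed

theorem lemma3p5:
  fixes A :: "('m::{t2_space, second_countable_topology}, 'n::finite) chart set"
    and g :: "('m, 'n) chart \<Rightarrow> 'm \<Rightarrow> real ^ 'n ^ 'n"
    and H :: "'m \<Rightarrow> real"
    and P :: "'w measure"
    and X :: "'w \<Rightarrow> 'm"
    and Xt :: "real \<Rightarrow> 'w \<Rightarrow> 'm"
    and f :: "'k::finite \<Rightarrow> 'm \<Rightarrow> real"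
    and W :: "'w \<Rightarrow> real ^ 'k"
    and Wt :: "real \<Rightarrow> 'w \<Rightarrow> real ^ 'k"
    and \<rho> :: real
  assumes manifold: "compact_riemannian_manifold A g"
    and H_smooth: "smooth_fun A H"
    and prob: "prob_space P"
    and X_meas: "X \<in> measurable P borel"
    and X_law: "distr P borel X = gibbs_measure A g H"
    and diffusion: "diffusion_generated_by A (generator A g H) P Xt"
    and start: "\<And>\<omega>. \<omega> \<in> space P \<Longrightarrow> Xt 0 \<omega> = X \<omega>"
    and f_smooth: "\<And>i. smooth_fun A (f i)"
    and W: "\<And>\<omega>. W \<omega> = (\<chi> i. f i (X \<omega>))"
    and Wt: "\<And>t \<omega>. Wt t \<omega> = (\<chi> i. f i (Xt t \<omega>))"
    and rho_pos: "\<rho> > 0"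
  shows "((\<lambda>t. 1 / t * (\<integral>\<omega>. (norm (Wt t \<omega> - W \<omega>))\<^sup>2 *
              indicator {\<omega>. (norm (Wt t \<omega> - W \<omega>))\<^sup>2 > \<rho>} \<omega> \<partial>P)) \<longlongrightarrow> 0) (at_right 0)"
proof -
  interpret prob_space P by (rule prob)
  let ?L = "generator A g H"
  have A: "smooth_atlas A" and g: "riemannian_metric A g" and compact: "compact (UNIV :: 'm set)"
    using manifold by (simp_all add: compact_riemannian_manifold_def)
  have Xt: "\<And>t. 0 \<le> t \<Longrightarrow> Xt t \<in> measurable P borel"
    and paths: "\<And>\<omega>. \<omega> \<in> space P \<Longrightarrow> continuous_on {0..} (\<lambda>t. Xt t \<omega>)"
    and mart: "\<And>h. smooth_fun A h \<Longrightarrow> is_martingale P (natural_filtration P Xt)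
      (\<lambda>t \<omega>. h (Xt t \<omega>) - h (Xt 0 \<omega>) - (\<integral>s\<in>{0..t}. ?L h (Xt s \<omega>) \<partial>lborel))"
    using diffusion by (auto simp: diffusion_generated_by_def)
  have power: "smooth_fun A (\<lambda>p. f i p ^ j)" if "j \<in> {1..4}" for i and j :: nat
    using smooth_fun_power[OF f_smooth] that by (cases j) (simp_all del: power_Suc)
  define m where "m i t = (\<integral>\<omega>. (f i (Xt t \<omega>) - f i (Xt 0 \<omega>)) ^ 4 \<partial>P)" for i t
  have m: "((\<lambda>t. 1 / t * m i t) \<longlongrightarrow> 0) (at_right 0)" for i
    unfolding m_def
  proof (rule fourth_moment_small_time[where L = ?L, OF prob compact Xt paths])
    show "continuous_on UNIV (f i)" by (rule smooth_fun_continuous_on[OF A f_smooth])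
    show "continuous_on UNIV (?L (\<lambda>p. f i p ^ j))" if "j \<in> {1..4}" for j
      by (rule generator_continuous_on[OF A g H_smooth power[OF that]])
  qed (use mart[OF power] generator_power[OF A g H_smooth f_smooth] in auto)
  have bound: "(\<integral>\<omega>. (norm (Wt t \<omega> - W \<omega>))\<^sup>2 * indicator {\<omega>. (norm (Wt t \<omega> - W \<omega>))\<^sup>2 > \<rho>} \<omega> \<partial>P)
      \<le> real CARD('k) / \<rho> * (\<Sum>i\<in>UNIV. m i t)" (is "?E t \<le> _") if t: "0 \<le> t" for t
  proof -
    have int: "integrable P (\<lambda>\<omega>. (f i (Xt t \<omega>) - f i (Xt 0 \<omega>)) ^ 4)" for i
      by (rule integrable_increment_power[OF prob compact smooth_fun_continuous_on[OF A f_smooth] Xt[OF t] Xt])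
        simp
    have "?E t \<le> (\<integral>\<omega>. real CARD('k) / \<rho> * (\<Sum>i\<in>UNIV. (f i (Xt t \<omega>) - f i (Xt 0 \<omega>)) ^ 4) \<partial>P)"
    proof (rule integral_mono')
      fix \<omega> assume \<omega>: "\<omega> \<in> space P"
      show "(norm (Wt t \<omega> - W \<omega>))\<^sup>2 * indicator {\<omega>. (norm (Wt t \<omega> - W \<omega>))\<^sup>2 > \<rho>} \<omega>
          \<le> real CARD('k) / \<rho> * (\<Sum>i\<in>UNIV. (f i (Xt t \<omega>) - f i (Xt 0 \<omega>)) ^ 4)"
        using norm_square_tail_le[OF rho_pos, of "Wt t \<omega> - W \<omega>"] start[OF \<omega>]
        by (simp add: W Wt indicator_def)
      show "0 \<le> real CARD('k) / \<rho> * (\<Sum>i\<in>UNIV. (f i (Xt t \<omega>) - f i (Xt 0 \<omega>)) ^ 4)"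
        using rho_pos by (simp add: sum_nonneg)
    qed (intro integrable_mult_right Bochner_Integration.integrable_sum int)
    also have "\<dots> = real CARD('k) / \<rho> * (\<Sum>i\<in>UNIV. m i t)"
      by (simp add: m_def int Bochner_Integration.integral_sum)
    finally show ?thesis .
  qed
  have "((\<lambda>t. real CARD('k) / \<rho> * (\<Sum>i\<in>UNIV. 1 / t * m i t)) \<longlongrightarrow> 0) (at_right 0)"
    by (rule tendsto_mult_right_zero[OF tendsto_null_sum[OF m]])
  then show ?thesis
  proof (rule tendsto_sandwich[OF _ _ tendsto_const, rotated 2])
    show "\<forall>\<^sub>F t in at_right 0. 0 \<le> 1 / t * ?E t"
      unfolding eventually_at_right_field
      by (intro exI[of _ 1]) (auto intro!: mult_nonneg_nonneg Bochner_Integration.integral_nonneg)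
    show "\<forall>\<^sub>F t in at_right 0. 1 / t * ?E t \<le> real CARD('k) / \<rho> * (\<Sum>i\<in>UNIV. 1 / t * m i t)"
      unfolding eventually_at_right_field
    proof (intro exI[of _ 1] conjI allI impI)
      fix t :: real assume "0 < t" "t < 1"
      then have "1 / t * ?E t \<le> 1 / t * (real CARD('k) / \<rho> * (\<Sum>i\<in>UNIV. m i t))"
        using bound[of t] by (intro mult_left_mono) auto
      then show "1 / t * ?E t \<le> real CARD('k) / \<rho> * (\<Sum>i\<in>UNIV. 1 / t * m i t)"
        by (simp add: sum_distrib_left[symmetric] mult.left_commute mult.commute[of \<rho>]
            sum_divide_distrib[symmetric])
    qed simp
  qed
qed

end
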